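(* Let $\phi,\eta:(\mathbb X,\sigma_0)\to(\mathbb Y,\tau_0)$ be two morphisms of developable complexes of groups over a (common) morphism of scwols $f:X\to Y$. Then $\phi$ and $\eta$ are homotopic relative $\sigma_0$ if and only if (i) the induced homomorphisms $\phi_\ast,\eta_\ast:\pi_1(\mathbb X,\sigma_0)\to\pi_1(\mathbb Y,\tau_0)$ coincide, i.e. $\phi_\ast=\eta_\ast$, and (ii) the induced morphisms $\tilde\phi,\tilde\eta:\tilde X_{\sigma_0}\to\tilde Y_{\tau_0}$ of universal complexes coincide, i.e. $\tilde\phi=\tilde\eta$.
   Context: Scwols. A scwol $X$ consists of sets $VX$ (vertices), $EX$ (edges), maps $i,t:EX\to VX$ and a composition $E^2X:=\{(a,b)\in EX\times EX: i(a)=t(b)\}\to EX$, $(a,b)\mapsto ab$, with $i(ab)=i(b)$, $t(ab)=t(a)$; $(ab)c=a(bc)$ whenever $i(a)=t(b)$, $i(b)=t(c)$; and $i(a)\neq t(a)$ for all $a\in EX$. $E^3X$ is the set of triples of edges $(a,b,c)$ with $i(a)=t(b)$, $i(b)=t(c)$. A morphism of scwols $f:X\to Y$ maps vertices to vertices and edges to edges, commutes with $i,t$, satisfies $f(ab)=f(a)f(b)$ for $(a,b)\in E^2X$, and for each $\sigma\in VX$ restricts to a bijection $\{a\in EX:i(a)=\sigma\}\to\{a'\in EY:i(a')=f(\sigma)\}$. Complexes of groups. A complex of groups $\mathbb X$ over $X$ is a tuple $((G_\sigma)_{\sigma\in VX},(\psi_a)_{a\in EX},(g_{a,b})_{(a,b)\in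 E^2X})$ with groups $G_\sigma$, injective homomorphisms $\psi_a:G_{i(a)}\to G_{t(a)}$ and elements $g_{a,b}\in G_{t(a)}$ such that $c_{g_{a,b}}\circ\psi_{ab}=\psi_a\circ\psi_b$ on $E^2X$ and $\psi_a(g_{b,c})g_{a,bc}=g_{a,b}g_{ab,c}$ on $E^3X$, where $c_h(g)=hgh^{-1}$. The same letters are used for all complexes of groups. Underlying scwols are always assumed connected (any two vertices are joined by a finite path as defined below). Morphisms. A morphism $\phi:\mathbb X\to\mathbb Y$ over $f:X\to Y$ consists of $f$, homomorphisms $\phi_\sigma:G_\sigma\to G_{f(\sigma)}$ ($\sigma\in VX$) and elements $\phi(a)\in G_{f(t(a))}$ ($a\in EX$) with $c_{\phi(a)}\circ\psi_{f(a)}\circ\phi_{i(a)}=\phi_{t(a)}\circ\psi_a$ for $a\in EX$ and $\phi_{t(a)}(g_{a,b})\phi(ab)=\phi(a)\psi_{f(a)}(\phi(b))g_{f(a),f(b)}$ for $(a,b)\in E^2X$. Writing $\phi:(\mathbb X,\sigma_0)\to(\mathbb Y,\tau_0)$ means $\sigma_0\in VX$ and $f(\sigma_0)=\tau_0$. Paths. Oriented edges are the $a\in EX$ and formal inverses $a^{-1}$, with $i(a^{-1})=t(a)$, $t(a^{-1})=i(a)$, $(a^{-1})^{-1}=a$. A path in $X$ is a finite sequence of oriented edges $(e_1,\dots,e_k)$ with $t(e_j)=i(e_{j+1})$. An $\mathbb X$-path is a tuple $p=(g_0,e_1,g_1,\dots,e_k,g_k)$ with $(e_1,\dots,e_k)$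 a path, $g_0\in G_{i(e_1)}$, $g_j\in G_{t(e_j)}$; $i(p)=i(e_1)$, $t(p)=t(e_k)$ (for length $0$: $p=(g)$ with $g\in G_\sigma$, at a vertex $\sigma$). Concatenation $p\star q$ (when $t(p)=i(q)$) multiplies the last group element of $p$ with the first of $q$. $\mathcal P_{\sigma}(\mathbb X)$ denotes the set of $\mathbb X$-paths starting at $\sigma$. Homotopy $\sim$ of $\mathbb X$-paths is the equivalence relation generated by the following replacements of subpaths: $(kg,a,h)\to(k,a,\psi_a(g)h)$; $(g,a^{-1},hk)\to(g\psi_a(h),a^{-1},k)$; $(g,a,\psi_a(h),a^{-1},k)\to(ghk)$; $(g,b^{-1},h,b,k)\to(g\psi_b(h)k)$; $(g,b,1,a,k)\to(g,ab,g_{a,b}^{-1}k)$ and $(g,a^{-1},1,b^{-1},k)\to(gg_{a,b},(ab)^{-1},k)$ for $(a,b)\in E^2X$. $[p]$ is the homotopy class. $\pi_1(\mathbb X,\sigma_0)$ is the group of homotopy classes of $\mathbb X$-paths from $\sigma_0$ to $\sigma_0$ with $[p][q]=[p\star q]$. $\mathbb X$ is developable if it arises (up to isomorphism) from an action of a group on a scwol; equivalently (and this may be taken as the definition), for every $\sigma\in VX$ the homomorphism $G_\sigma\to\pi_1(\mathbb X,\sigma)$, $g\mapsto[(g)]$, is injective. Universal complex. For $p,q\in\mathcal P_{\sigma_0}(\mathbb X)$ put $p\equiv q$ iff $[q]=[p\star(g)]$ for some $g\in G_{t(p)}$; $[\![p]\!]$ is the $\equiv$-class. The scwol $\tilde X_{\sigma_0}$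 has vertices $[\![p]\!]$, $p\in\mathcal P_{\sigma_0}(\mathbb X)$, edges the triples $([\![p]\!],a,[\![p\star(1,a,1)]\!])$ with $a\in EX$, $i(a)=t(p)$; $i,t$ are the first and third projections, and the composite of $([\![p\star(1,b,1)]\!],a,\cdot)$ with $([\![p]\!],b,\cdot)$ is $([\![p]\!],ab,[\![p\star(1,ab,1)]\!])$. Induced maps. $\mathfrak p_\phi$ is the map from $\mathbb X$-paths to $\mathbb Y$-paths compatible with $\star$ and given by $(g)\mapsto(\phi_\sigma(g))$ for $g\in G_\sigma$, $(1,a,1)\mapsto(1,f(a),\phi(a)^{-1})$, $(1,a^{-1},1)\mapsto(\phi(a),f(a)^{-1},1)$; $\phi_\ast=\phi_{\ast,\sigma_0}:\pi_1(\mathbb X,\sigma_0)\to\pi_1(\mathbb Y,\tau_0)$ is $[p]\mapsto[\mathfrak p_\phi(p)]$, and $\tilde\phi:\tilde X_{\sigma_0}\to\tilde Y_{\tau_0}$ is the morphism $[\![p]\!]\mapsto[\![\mathfrak p_\phi(p)]\!]$, $([\![p]\!],a,\cdot)\mapsto([\![\mathfrak p_\phi(p)]\!],f(a),\cdot)$. Homotopy of morphisms. For morphisms $\phi,\eta:\mathbb X\to\mathbb Y$ over the same $f$, a family $k_\sigma\in G_{f(\sigma)}$ ($\sigma\in VX$) defines a homotopy from $\phi$ to $\eta$ if $\eta_\sigma=c_{k_\sigma}\circ\phi_\sigma$ and $\eta(a)=k_{t(a)}\phi(a)\psi_{f(a)}(k_{i(a)}^{-1})$ for all $\sigma\in VX$,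 $a\in EX$. $\phi$ and $\eta$ are homotopic relative $\sigma_0$ if such a family exists with $k_{\sigma_0}=1$. *)

theory Defs
  imports "HOL-Algebra.Group" "HOL-Library.FuncSet"
begin

section \<open>Scwols\<close>

text \<open>
  The composition is total; \<open>cmp X a b\<close> stands for the composite \<open>ab\<close> and is only meaningful
  when \<open>ini X a = ter X b\<close>, i.e. \<open>b\<close> is traversed first.
\<close>

record ('v, 'e) scwol =
  verts :: "'v set"
  edges :: "'e set"
  ini :: "'e \<Rightarrow> 'v"
  ter :: "'e \<Rightarrow> 'v"
  cmp :: "'e \<Rightarrow> 'e \<Rightarrow> 'e"

definition edges2 :: "('v, 'e, 'z) scwol_scheme \<Rightarrow> ('e \<times> 'e) set" where
  "edges2 X = {(a, b). a \<in> edges X \<and> b \<in> edges X \<and> ini X a = ter X b}"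

definition edges3 :: "('v, 'e, 'z) scwol_scheme \<Rightarrow> ('e \<times> 'e \<times> 'e) set" where
  "edges3 X = {(a, b, c). (a, b) \<in> edges2 X \<and> (b, c) \<in> edges2 X}"

locale scwol =
  fixes X :: "('v, 'e, 'z) scwol_scheme"
  assumes ini_closed: "a \<in> edges X \<Longrightarrow> ini X a \<in> verts X"
    and ter_closed: "a \<in> edges X \<Longrightarrow> ter X a \<in> verts X"
    and cmp_closed: "(a, b) \<in> edges2 X \<Longrightarrow> cmp X a b \<in> edges X"
    and ini_cmp: "(a, b) \<in> edges2 X \<Longrightarrow> ini X (cmp X a b) = ini X b"
    and ter_cmp: "(a, b) \<in> edges2 X \<Longrightarrow> ter X (cmp X a b) = ter X a"
    and cmp_assoc: "(a, b, c) \<in> edges3 X \<Longrightarrow> cmp X (cmp X a b) c = cmp X a (cmp X b c)"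
    and no_loops: "a \<in> edges X \<Longrightarrow> ini X a \<noteq> ter X a"

record ('v, 'e, 'w, 'd) scwol_map =
  vmap :: "'v \<Rightarrow> 'w"
  emap :: "'e \<Rightarrow> 'd"

locale scwol_morphism = source: scwol X + target: scwol Y
  for X :: "('v, 'e, 'y) scwol_scheme" and Y :: "('w, 'd, 'z) scwol_scheme" +
  fixes f :: "('v, 'e, 'w, 'd) scwol_map"
  assumes vmap_closed: "\<sigma> \<in> verts X \<Longrightarrow> vmap f \<sigma> \<in> verts Y"
    and emap_closed: "a \<in> edges X \<Longrightarrow> emap f a \<in> edges Y"
    and ini_emap: "a \<in> edges X \<Longrightarrow> ini Y (emap f a) = vmap f (ini X a)"
    and ter_emap: "a \<in> edges X \<Longrightarrow> ter Y (emap f a) = vmap f (ter X a)"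
    and emap_cmp: "(a, b) \<in> edges2 X \<Longrightarrow> emap f (cmp X a b) = cmp Y (emap f a) (emap f b)"
    and bij_star: "\<sigma> \<in> verts X \<Longrightarrow>
      bij_betw (emap f) {a \<in> edges X. ini X a = \<sigma>} {a' \<in> edges Y. ini Y a' = vmap f \<sigma>}"


section \<open>Paths in scwols\<close>

text \<open>\<open>Bwd a\<close> is the formal inverse of \<open>a\<close>.\<close>

datatype 'e oedge = Fwd 'e | Bwd 'e

definition oedges :: "('v, 'e, 'z) scwol_scheme \<Rightarrow> 'e oedge set" where
  "oedges X = Fwd ` edges X \<union> Bwd ` edges X"

fun oini :: "('v, 'e, 'z) scwol_scheme \<Rightarrow> 'e oedge \<Rightarrow> 'v" where
  "oini X (Fwd a) = ini X a"
| "oini X (Bwd a) = ter X a"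

fun oter :: "('v, 'e, 'z) scwol_scheme \<Rightarrow> 'e oedge \<Rightarrow> 'v" where
  "oter X (Fwd a) = ter X a"
| "oter X (Bwd a) = ini X a"

fun scwol_path :: "('v, 'e, 'z) scwol_scheme \<Rightarrow> 'v \<Rightarrow> 'e oedge list \<Rightarrow> 'v \<Rightarrow> bool" where
  "scwol_path X \<sigma> [] \<tau> \<longleftrightarrow> \<sigma> = \<tau>"
| "scwol_path X \<sigma> (e # es) \<tau> \<longleftrightarrow>
     e \<in> oedges X \<and> oini X e = \<sigma> \<and> scwol_path X (oter X e) es \<tau>"

locale connected_scwol = scwol +
  assumes connected: "\<lbrakk>\<sigma> \<in> verts X; \<tau> \<in> verts X\<rbrakk> \<Longrightarrow> \<exists>es. scwol_path X \<sigma> es \<tau>"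


section \<open>Complexes of groups\<close>

definition conj_by :: "('g, 'm) monoid_scheme \<Rightarrow> 'g \<Rightarrow> 'g \<Rightarrow> 'g" where
  "conj_by G h g = h \<otimes>\<^bsub>G\<^esub> g \<otimes>\<^bsub>G\<^esub> inv\<^bsub>G\<^esub> h"

text \<open>
  The local groups share one element type but are otherwise unrelated; their carriers may
  overlap.
\<close>

record ('v, 'e, 'g) group_complex = "('v, 'e) scwol" +
  grp :: "'v \<Rightarrow> 'g monoid"
  psi :: "'e \<Rightarrow> 'g \<Rightarrow> 'g"
  twist :: "'e \<Rightarrow> 'e \<Rightarrow> 'g"

locale complex_of_groups = connected_scwol X
  for X :: "('v, 'e, 'g) group_complex" +
  assumes group_grp: "\<sigma> \<in> verts X \<Longrightarrow> group (grp X \<sigma>)"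
    and psi_hom: "a \<in> edges X \<Longrightarrow> psi X a \<in> hom (grp X (ini X a)) (grp X (ter X a))"
    and psi_inj: "a \<in> edges X \<Longrightarrow> inj_on (psi X a) (carrier (grp X (ini X a)))"
    and twist_closed: "(a, b) \<in> edges2 X \<Longrightarrow> twist X a b \<in> carrier (grp X (ter X a))"
    and twist_conj: "\<lbrakk>(a, b) \<in> edges2 X; g \<in> carrier (grp X (ini X b))\<rbrakk> \<Longrightarrow>
      conj_by (grp X (ter X a)) (twist X a b) (psi X (cmp X a b) g) = psi X a (psi X b g)"
    and twist_cocycle: "(a, b, c) \<in> edges3 X \<Longrightarrow>
      psi X a (twist X b c) \<otimes>\<^bsub>grp X (ter X a)\<^esub> twist X a (cmp X b c)
        = twist X a b \<otimes>\<^bsub>grp X (ter X a)\<^esub> twist X (cmp X a b) c"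

text \<open>
  A morphism over a fixed scwol morphism \<open>f\<close> consists of the local homomorphisms and the edge
  elements.
\<close>

record ('v, 'e, 'g, 'h) complex_map =
  loc :: "'v \<Rightarrow> 'g \<Rightarrow> 'h"
  elt :: "'e \<Rightarrow> 'h"

locale complex_morphism =
  source: complex_of_groups X + target: complex_of_groups Y + scwol_morphism X Y f
  for X :: "('v, 'e, 'g) group_complex" and Y :: "('w, 'd, 'h) group_complex"
    and f :: "('v, 'e, 'w, 'd) scwol_map" +
  fixes \<phi> :: "('v, 'e, 'g, 'h) complex_map"
  assumes loc_hom: "\<sigma> \<in> verts X \<Longrightarrow> loc \<phi> \<sigma> \<in> hom (grp X \<sigma>) (grp Y (vmap f \<sigma>))"
    and elt_closed: "a \<in> edges X \<Longrightarrow> elt \<phi> a \<in> carrier (grp Y (vmap f (ter X a)))"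
    and elt_conj: "\<lbrakk>a \<in> edges X; g \<in> carrier (grp X (ini X a))\<rbrakk> \<Longrightarrow>
      conj_by (grp Y (vmap f (ter X a))) (elt \<phi> a) (psi Y (emap f a) (loc \<phi> (ini X a) g))
        = loc \<phi> (ter X a) (psi X a g)"
    and elt_twist: "(a, b) \<in> edges2 X \<Longrightarrow>
      loc \<phi> (ter X a) (twist X a b) \<otimes>\<^bsub>grp Y (vmap f (ter X a))\<^esub> elt \<phi> (cmp X a b)
        = elt \<phi> a \<otimes>\<^bsub>grp Y (vmap f (ter X a))\<^esub> psi Y (emap f a) (elt \<phi> b)
            \<otimes>\<^bsub>grp Y (vmap f (ter X a))\<^esub> twist Y (emap f a) (emap f b)"


section \<open>Paths in complexes of groups\<close>

text \<open>
  The tuple \<open>(g\<^sub>0, e\<^sub>1, g\<^sub>1, \<dots>, e\<^sub>k, g\<^sub>k)\<close> is represented by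
  \<open>Step g\<^sub>0 e\<^sub>1 (Step g\<^sub>1 e\<^sub>2 (\<dots> (Elt \<sigma> g\<^sub>k)))\<close> with \<open>\<sigma>\<close> the end vertex. Recording \<open>\<sigma>\<close>
  distinguishes paths of length zero at different vertices; for positive length it is forced
  by \<open>is_path\<close>.
\<close>

datatype ('v, 'e, 'g) gpath = Elt 'v 'g | Step 'g "'e oedge" "('v, 'e, 'g) gpath"

fun pini :: "('v, 'e, 'z) scwol_scheme \<Rightarrow> ('v, 'e, 'g) gpath \<Rightarrow> 'v" where
  "pini X (Elt \<sigma> g) = \<sigma>"
| "pini X (Step g e p) = oini X e"

fun pter :: "('v, 'e, 'g) gpath \<Rightarrow> 'v" where
  "pter (Elt \<sigma> g) = \<sigma>"
| "pter (Step g e p) = pter p"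

fun is_path :: "('v, 'e, 'g) group_complex \<Rightarrow> ('v, 'e, 'g) gpath \<Rightarrow> bool" where
  "is_path X (Elt \<sigma> g) \<longleftrightarrow> \<sigma> \<in> verts X \<and> g \<in> carrier (grp X \<sigma>)"
| "is_path X (Step g e p) \<longleftrightarrow>
     e \<in> oedges X \<and> g \<in> carrier (grp X (oini X e)) \<and> pini X p = oter X e \<and> is_path X p"

definition paths_from :: "('v, 'e, 'g) group_complex \<Rightarrow> 'v \<Rightarrow> ('v, 'e, 'g) gpath set" where
  "paths_from X \<sigma> = {p. is_path X p \<and> pini X p = \<sigma>}"

definition loops_at :: "('v, 'e, 'g) group_complex \<Rightarrow> 'v \<Rightarrow> ('v, 'e, 'g) gpath set" where
  "loops_at X \<sigma> = {p \<in> paths_from X \<sigma>. pter p = \<sigma>}"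

fun left_mult :: "('v, 'e, 'g) group_complex \<Rightarrow> 'g \<Rightarrow> ('v, 'e, 'g) gpath \<Rightarrow> ('v, 'e, 'g) gpath" where
  "left_mult X g (Elt \<sigma> h) = Elt \<sigma> (g \<otimes>\<^bsub>grp X \<sigma>\<^esub> h)"
| "left_mult X g (Step h e p) = Step (g \<otimes>\<^bsub>grp X (oini X e)\<^esub> h) e p"

fun pconcat :: "('v, 'e, 'g) group_complex \<Rightarrow> ('v, 'e, 'g) gpath \<Rightarrow> ('v, 'e, 'g) gpath
    \<Rightarrow> ('v, 'e, 'g) gpath" where
  "pconcat X (Elt \<sigma> g) q = left_mult X g q"
| "pconcat X (Step g e p) q = Step g e (pconcat X p q)"

text \<open>The path \<open>(1, e, 1)\<close>.\<close>

definition edge_path :: "('v, 'e, 'g) group_complex \<Rightarrow> 'e oedge \<Rightarrow> ('v, 'e, 'g) gpath" where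
  "edge_path X e = Step \<one>\<^bsub>grp X (oini X e)\<^esub> e (Elt (oter X e) \<one>\<^bsub>grp X (oter X e)\<^esub>)"


section \<open>Homotopy of paths and the fundamental group\<close>

inductive elementary :: "('v, 'e, 'g) group_complex \<Rightarrow> ('v, 'e, 'g) gpath \<Rightarrow> ('v, 'e, 'g) gpath
    \<Rightarrow> bool" for X where
  slide_fwd: "\<lbrakk>a \<in> edges X; k \<in> carrier (grp X (ini X a)); g \<in> carrier (grp X (ini X a));
      h \<in> carrier (grp X (ter X a))\<rbrakk> \<Longrightarrow>
    elementary X
      (Step (k \<otimes>\<^bsub>grp X (ini X a)\<^esub> g) (Fwd a) (Elt (ter X a) h))
      (Step k (Fwd a) (Elt (ter X a) (psi X a g \<otimes>\<^bsub>grp X (ter X a)\<^esub> h)))"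
| slide_bwd: "\<lbrakk>a \<in> edges X; g \<in> carrier (grp X (ter X a)); h \<in> carrier (grp X (ini X a));
      k \<in> carrier (grp X (ini X a))\<rbrakk> \<Longrightarrow>
    elementary X
      (Step g (Bwd a) (Elt (ini X a) (h \<otimes>\<^bsub>grp X (ini X a)\<^esub> k)))
      (Step (g \<otimes>\<^bsub>grp X (ter X a)\<^esub> psi X a h) (Bwd a) (Elt (ini X a) k))"
| cancel_fwd: "\<lbrakk>a \<in> edges X; g \<in> carrier (grp X (ini X a)); h \<in> carrier (grp X (ini X a));
      k \<in> carrier (grp X (ini X a))\<rbrakk> \<Longrightarrow>
    elementary X
      (Step g (Fwd a) (Step (psi X a h) (Bwd a) (Elt (ini X a) k)))
      (Elt (ini X a) (g \<otimes>\<^bsub>grp X (ini X a)\<^esub> h \<otimes>\<^bsub>grp X (ini X a)\<^esub> k))"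
| cancel_bwd: "\<lbrakk>b \<in> edges X; g \<in> carrier (grp X (ter X b)); h \<in> carrier (grp X (ini X b));
      k \<in> carrier (grp X (ter X b))\<rbrakk> \<Longrightarrow>
    elementary X
      (Step g (Bwd b) (Step h (Fwd b) (Elt (ter X b) k)))
      (Elt (ter X b) (g \<otimes>\<^bsub>grp X (ter X b)\<^esub> psi X b h \<otimes>\<^bsub>grp X (ter X b)\<^esub> k))"
| compose_fwd: "\<lbrakk>(a, b) \<in> edges2 X; g \<in> carrier (grp X (ini X b));
      k \<in> carrier (grp X (ter X a))\<rbrakk> \<Longrightarrow>
    elementary X
      (Step g (Fwd b) (Step \<one>\<^bsub>grp X (ini X a)\<^esub> (Fwd a) (Elt (ter X a) k)))
      (Step g (Fwd (cmp X a b))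
        (Elt (ter X a) (inv\<^bsub>grp X (ter X a)\<^esub> twist X a b \<otimes>\<^bsub>grp X (ter X a)\<^esub> k)))"
| compose_bwd: "\<lbrakk>(a, b) \<in> edges2 X; g \<in> carrier (grp X (ter X a));
      k \<in> carrier (grp X (ini X b))\<rbrakk> \<Longrightarrow>
    elementary X
      (Step g (Bwd a) (Step \<one>\<^bsub>grp X (ini X a)\<^esub> (Bwd b) (Elt (ini X b) k)))
      (Step (g \<otimes>\<^bsub>grp X (ter X a)\<^esub> twist X a b) (Bwd (cmp X a b)) (Elt (ini X b) k))"

text \<open>
  Replacing a subpath \<open>s\<close> by \<open>s'\<close>. As the outer elements of \<open>s\<close> are arbitrary, writing the
  surrounding tuple as \<open>r \<star> s \<star> r'\<close> yields exactly the replacements of a contiguous piece of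
  the tuple.
\<close>

inductive replace_subpath :: "('v, 'e, 'g) group_complex \<Rightarrow> ('v, 'e, 'g) gpath
    \<Rightarrow> ('v, 'e, 'g) gpath \<Rightarrow> bool" for X where
  "\<lbrakk>elementary X s s'; is_path X r; is_path X r'; pter r = pini X s; pini X r' = pter s\<rbrakk> \<Longrightarrow>
    replace_subpath X (pconcat X r (pconcat X s r')) (pconcat X r (pconcat X s' r'))"

definition homotopy_rel :: "('v, 'e, 'g) group_complex
    \<Rightarrow> (('v, 'e, 'g) gpath \<times> ('v, 'e, 'g) gpath) set" where
  "homotopy_rel X = {(p, q). is_path X p \<and> is_path X q \<and> equivclp (replace_subpath X) p q}"

definition homotopy_class :: "('v, 'e, 'g) group_complex \<Rightarrow> ('v, 'e, 'g) gpath
    \<Rightarrow> ('v, 'e, 'g) gpath set" where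
  "homotopy_class X p = homotopy_rel X `` {p}"

text \<open>
  Here and below, a union over the members of a class, all of which contribute the same set, stands
  for the choice of a representative.
\<close>

definition pi1 :: "('v, 'e, 'g) group_complex \<Rightarrow> 'v \<Rightarrow> ('v, 'e, 'g) gpath set monoid" where
  "pi1 X \<sigma> = \<lparr>carrier = homotopy_class X ` loops_at X \<sigma>,
     mult = (\<lambda>A B. \<Union>p\<in>A. \<Union>q\<in>B. homotopy_class X (pconcat X p q)),
     one = homotopy_class X (Elt \<sigma> \<one>\<^bsub>grp X \<sigma>\<^esub>)\<rparr>"

text \<open>
  Developability in the sense of arising from a group action on a scwol is equivalent to injectivity
  of \<open>grp X \<sigma> \<rightarrow> pi1 X \<sigma>\<close> for every vertex; the latter serves as the definition.
\<close>

definition developable :: "('v, 'e, 'g) group_complex \<Rightarrow> bool" where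
  "developable X \<longleftrightarrow>
     (\<forall>\<sigma>\<in>verts X. inj_on (\<lambda>g. homotopy_class X (Elt \<sigma> g)) (carrier (grp X \<sigma>)))"


section \<open>The universal complex\<close>

definition universal_class :: "('v, 'e, 'g) group_complex \<Rightarrow> 'v \<Rightarrow> ('v, 'e, 'g) gpath
    \<Rightarrow> ('v, 'e, 'g) gpath set" where
  "universal_class X \<sigma>\<^sub>0 p = {q \<in> paths_from X \<sigma>\<^sub>0.
     \<exists>g\<in>carrier (grp X (pter p)). homotopy_class X q = homotopy_class X (pconcat X p (Elt (pter p) g))}"

definition universal_complex :: "('v, 'e, 'g) group_complex \<Rightarrow> 'v
    \<Rightarrow> (('v, 'e, 'g) gpath set, ('v, 'e, 'g) gpath set \<times> 'e \<times> ('v, 'e, 'g) gpath set) scwol" where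
  "universal_complex X \<sigma>\<^sub>0 = \<lparr>
     verts = universal_class X \<sigma>\<^sub>0 ` paths_from X \<sigma>\<^sub>0,
     edges = {(universal_class X \<sigma>\<^sub>0 p, a, universal_class X \<sigma>\<^sub>0 (pconcat X p (edge_path X (Fwd a)))) | p a.
       p \<in> paths_from X \<sigma>\<^sub>0 \<and> a \<in> edges X \<and> ini X a = pter p},
     ini = (\<lambda>(u, a, v). u),
     ter = (\<lambda>(u, a, v). v),
     cmp = (\<lambda>(_, a, _) (u, b, _).
       (u, cmp X a b,
        \<Union>p\<in>u. universal_class X \<sigma>\<^sub>0 (pconcat X p (edge_path X (Fwd (cmp X a b))))))\<rparr>"


section \<open>Induced maps\<close>

fun edge_image :: "('v, 'e, 'g) group_complex \<Rightarrow> ('w, 'd, 'h) group_complex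
    \<Rightarrow> ('v, 'e, 'w, 'd) scwol_map \<Rightarrow> ('v, 'e, 'g, 'h) complex_map
    \<Rightarrow> 'e oedge \<Rightarrow> ('w, 'd, 'h) gpath" where
  "edge_image X Y f \<phi> (Fwd a) =
     Step \<one>\<^bsub>grp Y (vmap f (ini X a))\<^esub> (Fwd (emap f a))
       (Elt (vmap f (ter X a)) (inv\<^bsub>grp Y (vmap f (ter X a))\<^esub> elt \<phi> a))"
| "edge_image X Y f \<phi> (Bwd a) =
     Step (elt \<phi> a) (Bwd (emap f a)) (Elt (vmap f (ini X a)) \<one>\<^bsub>grp Y (vmap f (ini X a))\<^esub>)"

fun path_map :: "('v, 'e, 'g) group_complex \<Rightarrow> ('w, 'd, 'h) group_complex
    \<Rightarrow> ('v, 'e, 'w, 'd) scwol_map \<Rightarrow> ('v, 'e, 'g, 'h) complex_map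
    \<Rightarrow> ('v, 'e, 'g) gpath \<Rightarrow> ('w, 'd, 'h) gpath" where
  "path_map X Y f \<phi> (Elt \<sigma> g) = Elt (vmap f \<sigma>) (loc \<phi> \<sigma> g)"
| "path_map X Y f \<phi> (Step g e p) =
     pconcat Y (Elt (vmap f (oini X e)) (loc \<phi> (oini X e) g))
       (pconcat Y (edge_image X Y f \<phi> e) (path_map X Y f \<phi> p))"

definition pi1_map :: "('v, 'e, 'g) group_complex \<Rightarrow> ('w, 'd, 'h) group_complex
    \<Rightarrow> ('v, 'e, 'w, 'd) scwol_map \<Rightarrow> ('v, 'e, 'g, 'h) complex_map
    \<Rightarrow> 'v \<Rightarrow> ('v, 'e, 'g) gpath set \<Rightarrow> ('w, 'd, 'h) gpath set" where
  "pi1_map X Y f \<phi> \<sigma>\<^sub>0 =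
     (\<lambda>A\<in>carrier (pi1 X \<sigma>\<^sub>0). \<Union>p\<in>A. homotopy_class Y (path_map X Y f \<phi> p))"

definition universal_map :: "('v, 'e, 'g) group_complex \<Rightarrow> ('w, 'd, 'h) group_complex
    \<Rightarrow> ('v, 'e, 'w, 'd) scwol_map \<Rightarrow> ('v, 'e, 'g, 'h) complex_map \<Rightarrow> 'v \<Rightarrow> 'w
    \<Rightarrow> (('v, 'e, 'g) gpath set, ('v, 'e, 'g) gpath set \<times> 'e \<times> ('v, 'e, 'g) gpath set,
        ('w, 'd, 'h) gpath set, ('w, 'd, 'h) gpath set \<times> 'd \<times> ('w, 'd, 'h) gpath set) scwol_map" where
  "universal_map X Y f \<phi> \<sigma>\<^sub>0 \<tau>\<^sub>0 = \<lparr>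
     vmap = (\<lambda>u\<in>verts (universal_complex X \<sigma>\<^sub>0).
       \<Union>p\<in>u. universal_class Y \<tau>\<^sub>0 (path_map X Y f \<phi> p)),
     emap = (\<lambda>(u, a, v)\<in>edges (universal_complex X \<sigma>\<^sub>0).
       (\<Union>p\<in>u. universal_class Y \<tau>\<^sub>0 (path_map X Y f \<phi> p),
        emap f a,
        \<Union>p\<in>u. universal_class Y \<tau>\<^sub>0 (pconcat Y (path_map X Y f \<phi> p) (edge_path Y (Fwd (emap f a))))))\<rparr>"


section \<open>Homotopy of morphisms\<close>

definition is_homotopy :: "('v, 'e, 'g) group_complex \<Rightarrow> ('w, 'd, 'h) group_complex
    \<Rightarrow> ('v, 'e, 'w, 'd) scwol_map \<Rightarrow> ('v, 'e, 'g, 'h) complex_map \<Rightarrow> ('v, 'e, 'g, 'h) complex_map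
    \<Rightarrow> ('v \<Rightarrow> 'h) \<Rightarrow> bool" where
  "is_homotopy X Y f \<phi> \<eta> k \<longleftrightarrow>
     (\<forall>\<sigma>\<in>verts X. k \<sigma> \<in> carrier (grp Y (vmap f \<sigma>))) \<and>
     (\<forall>\<sigma>\<in>verts X. \<forall>g\<in>carrier (grp X \<sigma>).
        loc \<eta> \<sigma> g = conj_by (grp Y (vmap f \<sigma>)) (k \<sigma>) (loc \<phi> \<sigma> g)) \<and>
     (\<forall>a\<in>edges X.
        elt \<eta> a = k (ter X a) \<otimes>\<^bsub>grp Y (vmap f (ter X a))\<^esub> elt \<phi> a
          \<otimes>\<^bsub>grp Y (vmap f (ter X a))\<^esub>
            psi Y (emap f a) (inv\<^bsub>grp Y (vmap f (ini X a))\<^esub> k (ini X a)))"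

definition homotopic_rel :: "('v, 'e, 'g) group_complex \<Rightarrow> ('w, 'd, 'h) group_complex
    \<Rightarrow> ('v, 'e, 'w, 'd) scwol_map \<Rightarrow> ('v, 'e, 'g, 'h) complex_map \<Rightarrow> ('v, 'e, 'g, 'h) complex_map
    \<Rightarrow> 'v \<Rightarrow> bool" where
  "homotopic_rel X Y f \<phi> \<eta> \<sigma>\<^sub>0 \<longleftrightarrow>
     (\<exists>k. is_homotopy X Y f \<phi> \<eta> k \<and> k \<sigma>\<^sub>0 = \<one>\<^bsub>grp Y (vmap f \<sigma>\<^sub>0)\<^esub>)"

end

theory Submission
  imports Defs
begin

text \<open>
  Write \<open>P p\<close> and \<open>Q p\<close> for the images of a path \<open>p\<close> under \<open>\<phi>\<close> and \<open>\<eta>\<close>. A homotopy \<open>k\<close> gives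
  \<open>Q p \<simeq> k\<^sub>i\<^sub>(\<^sub>p\<^sub>) \<star> P p \<star> k\<^sub>t\<^sub>(\<^sub>p\<^sub>)\<^sup>-\<^sup>1\<close>, so the induced maps agree when \<open>k\<close> is trivial at the base vertex.
  Conversely, (ii) yields for each \<open>p\<close> from the base vertex an element \<open>k\<close> with \<open>P p \<simeq> Q p \<star> (k)\<close>,
  and by (i) it depends only on the end vertex of \<open>p\<close>. Comparing \<open>p\<close> with \<open>p \<star> (g)\<close> and
  \<open>p \<star> (1, a, 1)\<close>, the equations of a homotopy hold up to homotopy of paths of length zero, and
  hence in the local groups by developability of the target.
\<close>

text \<open>Each induced map is a union over the members of a class. Its equality for \<phi> and
  \<eta> therefore only relates \<open>P p\<close> to \<open>Q q\<close> for some other member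
  \<open>q\<close>, and returning to \<open>p\<close> requires that \<open>path_map\<close> respects
  homotopy. This is where the compatibility axioms of a morphism enter: the conjugation axiom for
  the sliding and cancelling moves, the cocycle axiom for the composing ones. The side on which
  \<open>k\<close> stands fixes the direction of the homotopy. Comparing \<open>p\<close> with
  \<open>p \<star> q\<close> for arbitrary \<open>q\<close> leads to one naturality relation,
  \<open>k\<close> at the start of \<open>q\<close> followed by \<open>P q\<close> against
  \<open>Q q\<close> followed by \<open>k\<close> at its end. The vertex equations are its instances
  at \<open>(g)\<close>, the edge equations its instances at \<open>(1, a, 1)\<close>. To obtain it,
  the common initial path \<open>Q p\<close> must be stripped off, and later the edge
  \<open>f(a)\<close> as well; hence the construction of reverse paths. Connectedness of X supplies
  a path \<open>p\<close> to every vertex, so that \<open>k\<close> is defined everywhere.\<close>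

definition homotopic :: "('v, 'e, 'g) gpath \<Rightarrow> ('v, 'e, 'g) group_complex
    \<Rightarrow> ('v, 'e, 'g) gpath \<Rightarrow> bool" ("_ \<simeq>\<^bsub>_\<^esub> _" [51, 0, 51] 50) where
  "p \<simeq>\<^bsub>X\<^esub> q \<longleftrightarrow> (p, q) \<in> homotopy_rel X"

section \<open>Concatenation and homotopy of paths\<close>

lemma pini_left_mult [simp]: "pini X (left_mult Y g p) = pini X p"
  by (cases p) auto

lemma pter_left_mult [simp]: "pter (left_mult X g p) = pter p"
  by (cases p) auto

lemma pter_pconcat [simp]: "pter (pconcat X p q) = pter q"
  by (induction p) auto

lemma pini_pconcat [simp]: "pter p = pini X q \<Longrightarrow> pini X (pconcat X p q) = pini X p"
  by (cases p) auto

context complex_of_groups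
begin

lemma oini_closed [simp]: "e \<in> oedges X \<Longrightarrow> oini X e \<in> verts X"
  by (auto simp: oedges_def ini_closed ter_closed)

lemma oter_closed [simp]: "e \<in> oedges X \<Longrightarrow> oter X e \<in> verts X"
  by (auto simp: oedges_def ini_closed ter_closed)

lemma Fwd_in_oedges [simp]: "Fwd a \<in> oedges X \<longleftrightarrow> a \<in> edges X"
  by (auto simp: oedges_def)

lemma Bwd_in_oedges [simp]: "Bwd a \<in> oedges X \<longleftrightarrow> a \<in> edges X"
  by (auto simp: oedges_def)

lemma oedge_cases:
  assumes "e \<in> oedges X"
  obtains a where "e = Fwd a" "a \<in> edges X" | a where "e = Bwd a" "a \<in> edges X"
  using assms by (auto simp: oedges_def)

lemma pini_closed [simp]: "is_path X p \<Longrightarrow> pini X p \<in> verts X"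
  by (cases p) auto

lemma pter_closed [simp]: "is_path X p \<Longrightarrow> pter p \<in> verts X"
  by (induction p) auto

section \<open>Arithmetic in the local groups\<close>

lemma grp_mult_closed [simp]:
  assumes "\<sigma> \<in> verts X" "g \<in> carrier (grp X \<sigma>)" "h \<in> carrier (grp X \<sigma>)"
  shows "g \<otimes>\<^bsub>grp X \<sigma>\<^esub> h \<in> carrier (grp X \<sigma>)"
  using assms group_grp group.is_monoid monoid.m_closed by metis

lemma grp_one_closed [simp]: "\<sigma> \<in> verts X \<Longrightarrow> \<one>\<^bsub>grp X \<sigma>\<^esub> \<in> carrier (grp X \<sigma>)"
  using group_grp group.is_monoid monoid.one_closed by metis

lemma grp_inv_closed [simp]:
  "\<lbrakk>\<sigma> \<in> verts X; g \<in> carrier (grp X \<sigma>)\<rbrakk> \<Longrightarrow> inv\<^bsub>grp X \<sigma>\<^esub> g \<in> carrier (grp X \<sigma>)"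
  using group_grp group.inv_closed by metis

lemma grp_assoc:
  assumes "\<sigma> \<in> verts X" "g \<in> carrier (grp X \<sigma>)" "h \<in> carrier (grp X \<sigma>)" "k \<in> carrier (grp X \<sigma>)"
  shows "g \<otimes>\<^bsub>grp X \<sigma>\<^esub> h \<otimes>\<^bsub>grp X \<sigma>\<^esub> k = g \<otimes>\<^bsub>grp X \<sigma>\<^esub> (h \<otimes>\<^bsub>grp X \<sigma>\<^esub> k)"
  using assms group_grp group.is_monoid monoid.m_assoc by metis

lemma grp_l_one [simp]: "\<lbrakk>\<sigma> \<in> verts X; g \<in> carrier (grp X \<sigma>)\<rbrakk> \<Longrightarrow> \<one>\<^bsub>grp X \<sigma>\<^esub> \<otimes>\<^bsub>grp X \<sigma>\<^esub> g = g"
  using group_grp group.is_monoid monoid.l_one by metis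

lemma grp_r_one [simp]: "\<lbrakk>\<sigma> \<in> verts X; g \<in> carrier (grp X \<sigma>)\<rbrakk> \<Longrightarrow> g \<otimes>\<^bsub>grp X \<sigma>\<^esub> \<one>\<^bsub>grp X \<sigma>\<^esub> = g"
  using group_grp group.is_monoid monoid.r_one by metis

lemma grp_l_inv [simp]:
  "\<lbrakk>\<sigma> \<in> verts X; g \<in> carrier (grp X \<sigma>)\<rbrakk> \<Longrightarrow> inv\<^bsub>grp X \<sigma>\<^esub> g \<otimes>\<^bsub>grp X \<sigma>\<^esub> g = \<one>\<^bsub>grp X \<sigma>\<^esub>"
  using group_grp group.l_inv by metis

lemma grp_r_inv [simp]:
  "\<lbrakk>\<sigma> \<in> verts X; g \<in> carrier (grp X \<sigma>)\<rbrakk> \<Longrightarrow> g \<otimes>\<^bsub>grp X \<sigma>\<^esub> inv\<^bsub>grp X \<sigma>\<^esub> g = \<one>\<^bsub>grp X \<sigma>\<^esub>"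
  using group_grp group.r_inv by metis

lemma grp_inv_mult_cancel [simp]:
  assumes "\<sigma> \<in> verts X" "g \<in> carrier (grp X \<sigma>)" "h \<in> carrier (grp X \<sigma>)"
  shows "inv\<^bsub>grp X \<sigma>\<^esub> g \<otimes>\<^bsub>grp X \<sigma>\<^esub> (g \<otimes>\<^bsub>grp X \<sigma>\<^esub> h) = h"
    "g \<otimes>\<^bsub>grp X \<sigma>\<^esub> (inv\<^bsub>grp X \<sigma>\<^esub> g \<otimes>\<^bsub>grp X \<sigma>\<^esub> h) = h"
  using assms by (simp_all add: grp_assoc[symmetric])

lemma grp_inv_mult:
  "\<lbrakk>\<sigma> \<in> verts X; g \<in> carrier (grp X \<sigma>); h \<in> carrier (grp X \<sigma>)\<rbrakk> \<Longrightarrow>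
    inv\<^bsub>grp X \<sigma>\<^esub> (g \<otimes>\<^bsub>grp X \<sigma>\<^esub> h) = inv\<^bsub>grp X \<sigma>\<^esub> h \<otimes>\<^bsub>grp X \<sigma>\<^esub> inv\<^bsub>grp X \<sigma>\<^esub> g"
  using group_grp group.inv_mult_group by metis

lemma psi_closed [simp]:
  "\<lbrakk>a \<in> edges X; g \<in> carrier (grp X (ini X a))\<rbrakk> \<Longrightarrow> psi X a g \<in> carrier (grp X (ter X a))"
  using psi_hom by (auto simp: hom_def)

lemma psi_group_hom: "a \<in> edges X \<Longrightarrow> group_hom (grp X (ini X a)) (grp X (ter X a)) (psi X a)"
  by (simp add: group_hom_def group_hom_axioms_def group_grp ini_closed ter_closed psi_hom)

lemma psi_one [simp]: "a \<in> edges X \<Longrightarrow> psi X a \<one>\<^bsub>grp X (ini X a)\<^esub> = \<one>\<^bsub>grp X (ter X a)\<^esub>"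
  using psi_group_hom group_hom.hom_one by blast

lemma psi_inv:
  "\<lbrakk>a \<in> edges X; g \<in> carrier (grp X (ini X a))\<rbrakk> \<Longrightarrow>
    psi X a (inv\<^bsub>grp X (ini X a)\<^esub> g) = inv\<^bsub>grp X (ter X a)\<^esub> psi X a g"
  using psi_group_hom group_hom.hom_inv by metis

section \<open>Associativity and units of concatenation\<close>

lemma is_path_left_mult [simp]:
  "\<lbrakk>is_path X p; g \<in> carrier (grp X (pini X p))\<rbrakk> \<Longrightarrow> is_path X (left_mult X g p)"
  by (cases p) auto

lemma left_mult_mult:
  "\<lbrakk>is_path X p; g \<in> carrier (grp X (pini X p)); h \<in> carrier (grp X (pini X p))\<rbrakk> \<Longrightarrow>
    left_mult X g (left_mult X h p) = left_mult X (g \<otimes>\<^bsub>grp X (pini X p)\<^esub> h) p"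
  by (cases p) (auto simp: grp_assoc)

lemma left_mult_one [simp]:
  "\<lbrakk>is_path X p; \<sigma> = pini X p\<rbrakk> \<Longrightarrow> left_mult X \<one>\<^bsub>grp X \<sigma>\<^esub> p = p"
  by (cases p) auto

lemma is_path_pconcat [simp]:
  "\<lbrakk>is_path X p; is_path X q; pter p = pini X q\<rbrakk> \<Longrightarrow> is_path X (pconcat X p q)"
  by (induction p) auto

text \<open>A path of length zero acts on the left by \<open>left_mult\<close>, so this is the base
  case of associativity.\<close>

lemma pconcat_left_mult:
  "\<lbrakk>is_path X p; is_path X q; pter p = pini X q; g \<in> carrier (grp X (pini X p))\<rbrakk> \<Longrightarrow>
    pconcat X (left_mult X g p) q = left_mult X g (pconcat X p q)"
  by (cases p) (auto simp: left_mult_mult)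

lemma pconcat_assoc:
  "\<lbrakk>is_path X p; is_path X q; is_path X r; pter p = pini X q; pter q = pini X r\<rbrakk> \<Longrightarrow>
    pconcat X (pconcat X p q) r = pconcat X p (pconcat X q r)"
  by (induction p) (auto simp: pconcat_left_mult)

lemma pconcat_one_right [simp]:
  "\<lbrakk>is_path X p; \<sigma> = pter p\<rbrakk> \<Longrightarrow> pconcat X p (Elt \<sigma> \<one>\<^bsub>grp X \<sigma>\<^esub>) = p"
  by (induction p) auto

section \<open>Homotopy preserves endpoints and is a congruence for concatenation\<close>

lemma edges2D:
  assumes "(a, b) \<in> edges2 X"
  shows "a \<in> edges X" "b \<in> edges X" "ter X b = ini X a"
  using assms by (auto simp: edges2_def)

lemma elementary_paths:
  assumes "elementary X s s'"
  shows "is_path X s \<and> is_path X s' \<and> pini X s = pini X s' \<and> pter s = pter s'"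
  using assms
  by cases (auto simp: ini_closed ter_closed cmp_closed ini_cmp ter_cmp twist_closed edges2D)

lemma replace_subpath_paths:
  assumes "replace_subpath X p q"
  shows "is_path X p \<and> is_path X q \<and> pini X p = pini X q \<and> pter p = pter q"
  using assms by cases (auto dest!: elementary_paths)

text \<open>\<open>equivclp\<close> is reflexive on all terms, valid or not, so validity can only be
  transferred from one side to the other.\<close>

lemma equivclp_replace_subpath_ends:
  assumes "equivclp (replace_subpath X) p q"
  shows "(is_path X p \<longleftrightarrow> is_path X q) \<and> pini X p = pini X q \<and> pter p = pter q"
  using assms by (induction rule: equivclp_induct) (auto dest: replace_subpath_paths)

lemma homotopic_ends:
  assumes "p \<simeq>\<^bsub>X\<^esub> q"
  shows "is_path X p" "is_path X q" "pini X p = pini X q" "pter p = pter q"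
  using assms equivclp_replace_subpath_ends[of p q] by (auto simp: homotopic_def homotopy_rel_def)

lemma homotopic_refl [simp]: "is_path X p \<Longrightarrow> p \<simeq>\<^bsub>X\<^esub> p"
  by (simp add: homotopic_def homotopy_rel_def)

lemma homotopic_sym: "p \<simeq>\<^bsub>X\<^esub> q \<Longrightarrow> q \<simeq>\<^bsub>X\<^esub> p"
  by (auto simp: homotopic_def homotopy_rel_def intro: equivclp_sym)

lemma homotopic_trans [trans]: "\<lbrakk>p \<simeq>\<^bsub>X\<^esub> q; q \<simeq>\<^bsub>X\<^esub> r\<rbrakk> \<Longrightarrow> p \<simeq>\<^bsub>X\<^esub> r"
  by (auto simp: homotopic_def homotopy_rel_def intro: equivclp_trans)

lemma replace_subpath_homotopic: "replace_subpath X p q \<Longrightarrow> p \<simeq>\<^bsub>X\<^esub> q"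
  using replace_subpath_paths by (auto simp: homotopic_def homotopy_rel_def r_into_equivclp)

text \<open>Reduces homotopy invariance of an operation to single replacements. The endpoint
  conditions in \<open>step\<close> allow an \<open>F\<close> that makes sense only for paths with
  the ends of \<open>p\<close>, such as concatenation with a fixed path. The assumption on
  \<open>F p\<close> says that \<open>F p\<close> is a path and starts the induction.\<close>

lemma homotopic_map:
  assumes "p \<simeq>\<^bsub>X\<^esub> q"
    and step: "\<And>u v. \<lbrakk>replace_subpath X u v; pini X u = pini X p; pter u = pter p\<rbrakk> \<Longrightarrow> F u \<simeq>\<^bsub>Y\<^esub> F v"
    and "F p \<simeq>\<^bsub>Y\<^esub> F p" and "complex_of_groups Y"
  shows "F p \<simeq>\<^bsub>Y\<^esub> F q"
proof -
  interpret Y: complex_of_groups Y by fact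
  have "equivclp (replace_subpath X) p q" using assms(1) by (simp add: homotopic_def homotopy_rel_def)
  then show ?thesis
  proof (induction rule: equivclp_induct)
    case base
    show ?case by fact
  next
    case (step y z)
    note ends = equivclp_replace_subpath_ends[OF step(1)]
    from step(2) have "F y \<simeq>\<^bsub>Y\<^esub> F z"
    proof
      assume "replace_subpath X y z"
      then show ?thesis using assms(2) ends by auto
    next
      assume "replace_subpath X z y"
      then show ?thesis using assms(2)[of z y] ends replace_subpath_paths[of z y] Y.homotopic_sym
        by auto
    qed
    with step.IH show ?case by (rule Y.homotopic_trans)
  qed
qed

text \<open>The right context \<open>r'\<close> of a replacement absorbs \<open>t\<close>, so the
  same elementary move is performed inside the longer path.\<close>

lemma homotopic_pconcat_right:
  assumes "p \<simeq>\<^bsub>X\<^esub> q" "is_path X t" "pter p = pini X t"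
  shows "pconcat X p t \<simeq>\<^bsub>X\<^esub> pconcat X q t"
proof (rule homotopic_map[OF assms(1)])
  fix u v assume uv: "replace_subpath X u v" "pini X u = pini X p" "pter u = pter p"
  then show "pconcat X u t \<simeq>\<^bsub>X\<^esub> pconcat X v t"
  proof cases
    case (1 s s' r r')
    note el = elementary_paths[OF 1(3)]
    have *: "pter r' = pini X t" using uv(3) 1 assms(3) by simp
    have "pconcat X u t = pconcat X r (pconcat X s (pconcat X r' t))"
      and "pconcat X v t = pconcat X r (pconcat X s' (pconcat X r' t))"
      using 1 el * assms(2) by (auto simp: pconcat_assoc)
    then show ?thesis
      using 1 el * assms(2) by (auto intro!: replace_subpath_homotopic replace_subpath.intros)
  qed
qed (use assms homotopic_ends complex_of_groups_axioms in auto)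

lemma homotopic_pconcat_left:
  assumes "p \<simeq>\<^bsub>X\<^esub> q" "is_path X t" "pter t = pini X p"
  shows "pconcat X t p \<simeq>\<^bsub>X\<^esub> pconcat X t q"
proof (rule homotopic_map[OF assms(1)])
  fix u v assume uv: "replace_subpath X u v" "pini X u = pini X p" "pter u = pter p"
  then show "pconcat X t u \<simeq>\<^bsub>X\<^esub> pconcat X t v"
  proof cases
    case (1 s s' r r')
    note el = elementary_paths[OF 1(3)]
    have *: "pter t = pini X r" using uv(2) 1 el assms(3) by simp
    have "pconcat X t u = pconcat X (pconcat X t r) (pconcat X s r')"
      and "pconcat X t v = pconcat X (pconcat X t r) (pconcat X s' r')"
      using 1 el * assms(2) by (auto simp: pconcat_assoc)
    then show ?thesis
      using 1 el * assms(2) by (auto intro!: replace_subpath_homotopic replace_subpath.intros)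
  qed
qed (use assms homotopic_ends complex_of_groups_axioms in auto)

lemma homotopic_left_mult:
  assumes "p \<simeq>\<^bsub>X\<^esub> q" "g \<in> carrier (grp X (pini X p))"
  shows "left_mult X g p \<simeq>\<^bsub>X\<^esub> left_mult X g q"
  using homotopic_pconcat_left[OF assms(1), of "Elt (pini X p) g"] homotopic_ends[OF assms(1)] assms
  by simp

lemma homotopic_Step:
  assumes "p \<simeq>\<^bsub>X\<^esub> q" "e \<in> oedges X" "g \<in> carrier (grp X (oini X e))" "pini X p = oter X e"
  shows "Step g e p \<simeq>\<^bsub>X\<^esub> Step g e q"
  using homotopic_pconcat_left[OF assms(1), of "Step g e (Elt (oter X e) \<one>\<^bsub>grp X (oter X e)\<^esub>)"]
    homotopic_ends[OF assms(1)] assms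
  by simp

section \<open>Elementary moves followed by an arbitrary tail\<close>

lemma elementary_homotopic:
  assumes "elementary X s s'"
  shows "s \<simeq>\<^bsub>X\<^esub> s'"
proof -
  note el = elementary_paths[OF assms]
  have "replace_subpath X
    (pconcat X (Elt (pini X s) \<one>\<^bsub>grp X (pini X s)\<^esub>) (pconcat X s (Elt (pter s) \<one>\<^bsub>grp X (pter s)\<^esub>)))
    (pconcat X (Elt (pini X s) \<one>\<^bsub>grp X (pini X s)\<^esub>) (pconcat X s' (Elt (pter s) \<one>\<^bsub>grp X (pter s)\<^esub>)))"
    using el by (intro replace_subpath.intros[OF assms]) auto
  then show ?thesis using el by (auto intro: replace_subpath_homotopic)
qed

lemma elementary_pconcat_homotopic:
  assumes "elementary X s s'" "is_path X r" "pini X r = pter s"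
  shows "pconcat X s r \<simeq>\<^bsub>X\<^esub> pconcat X s' r"
  using homotopic_pconcat_right[OF elementary_homotopic[OF assms(1)]] assms by simp

text \<open>An elementary move ends in an arbitrary group element. Taking this element to be 1 and
  concatenating with \<open>r\<close> moves the remaining factor onto the first element of
  \<open>r\<close>. The next three lemmas arise in the same way.\<close>

lemma homotopic_slide_fwd:
  assumes "a \<in> edges X" "k \<in> carrier (grp X (ini X a))" "g \<in> carrier (grp X (ini X a))"
    "is_path X r" "pini X r = ter X a"
  shows "Step (k \<otimes>\<^bsub>grp X (ini X a)\<^esub> g) (Fwd a) r \<simeq>\<^bsub>X\<^esub> Step k (Fwd a) (left_mult X (psi X a g) r)"
  using elementary_pconcat_homotopic[OF slide_fwd[of a X k g "\<one>\<^bsub>grp X (ter X a)\<^esub>"], of r] assms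
  by (simp add: ini_closed ter_closed)

lemma homotopic_slide_bwd:
  assumes "a \<in> edges X" "g \<in> carrier (grp X (ter X a))" "h \<in> carrier (grp X (ini X a))"
    "is_path X r" "pini X r = ini X a"
  shows "Step g (Bwd a) (left_mult X h r) \<simeq>\<^bsub>X\<^esub> Step (g \<otimes>\<^bsub>grp X (ter X a)\<^esub> psi X a h) (Bwd a) r"
  using elementary_pconcat_homotopic[OF slide_bwd[of a X g h "\<one>\<^bsub>grp X (ini X a)\<^esub>"], of r] assms
  by (simp add: ini_closed ter_closed)

lemma homotopic_cancel_fwd:
  assumes "a \<in> edges X" "g \<in> carrier (grp X (ini X a))" "h \<in> carrier (grp X (ini X a))"
    "is_path X r" "pini X r = ini X a"
  shows "Step g (Fwd a) (Step (psi X a h) (Bwd a) r) \<simeq>\<^bsub>X\<^esub> left_mult X (g \<otimes>\<^bsub>grp X (ini X a)\<^esub> h) r"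
  using elementary_pconcat_homotopic[OF cancel_fwd[of a X g h "\<one>\<^bsub>grp X (ini X a)\<^esub>"], of r] assms
  by (simp add: ini_closed ter_closed)

lemma homotopic_cancel_bwd:
  assumes "b \<in> edges X" "g \<in> carrier (grp X (ter X b))" "h \<in> carrier (grp X (ini X b))"
    "is_path X r" "pini X r = ter X b"
  shows "Step g (Bwd b) (Step h (Fwd b) r) \<simeq>\<^bsub>X\<^esub> left_mult X (g \<otimes>\<^bsub>grp X (ter X b)\<^esub> psi X b h) r"
  using elementary_pconcat_homotopic[OF cancel_bwd[of b X g h "\<one>\<^bsub>grp X (ter X b)\<^esub>"], of r] assms
  by (simp add: ini_closed ter_closed)

section \<open>Reverse paths, cancellation and connectedness\<close>

text \<open>The reverse of \<open>(g, e, p)\<close> is \<open>p\<^sup>-\<^sup>1 \<star> (1, e\<^sup>-\<^sup>1, g\<^sup>-\<^sup>1)\<close>.\<close>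

lemma reverse_path_exists:
  assumes "is_path X p"
  obtains q where "is_path X q" "pini X q = pter p" "pter q = pini X p"
    "pconcat X p q \<simeq>\<^bsub>X\<^esub> Elt (pini X p) \<one>\<^bsub>grp X (pini X p)\<^esub>"
    "pconcat X q p \<simeq>\<^bsub>X\<^esub> Elt (pter p) \<one>\<^bsub>grp X (pter p)\<^esub>"
proof -
  have "\<exists>q. is_path X q \<and> pini X q = pter p \<and> pter q = pini X p
    \<and> pconcat X p q \<simeq>\<^bsub>X\<^esub> Elt (pini X p) \<one>\<^bsub>grp X (pini X p)\<^esub>
    \<and> pconcat X q p \<simeq>\<^bsub>X\<^esub> Elt (pter p) \<one>\<^bsub>grp X (pter p)\<^esub>"
    using assms
  proof (induction p)
    case (Elt \<sigma> g)
    then show ?case by (intro exI[of _ "Elt \<sigma> (inv\<^bsub>grp X \<sigma>\<^esub> g)"]) simp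
  next
    case (Step g e p)
    then obtain q where q: "is_path X q" "pini X q = pter p" "pter q = pini X p"
      "pconcat X p q \<simeq>\<^bsub>X\<^esub> Elt (pini X p) \<one>\<^bsub>grp X (pini X p)\<^esub>"
      "pconcat X q p \<simeq>\<^bsub>X\<^esub> Elt (pter p) \<one>\<^bsub>grp X (pter p)\<^esub>" by auto
    have p: "is_path X p" "pini X p = oter X e" and e: "e \<in> oedges X"
      and g: "g \<in> carrier (grp X (oini X e))" using Step.prems by auto
    define i where "i = (case e of Fwd a \<Rightarrow> Bwd a | Bwd a \<Rightarrow> Fwd a)"
    have i: "i \<in> oedges X" "oini X i = oter X e" "oter X i = oini X e"
      using e by (auto simp: i_def elim: oedge_cases)
    let ?g = "inv\<^bsub>grp X (oini X e)\<^esub> g"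
    let ?s = "Step \<one>\<^bsub>grp X (oter X e)\<^esub> i (Elt (oini X e) ?g)"
    have s: "is_path X ?s" using e i g by simp
    \<comment> \<open>The unit between \<open>e\<close> and its inverse is the image of a unit under
      \<open>psi\<close> if \<open>e\<close> is a forward edge, and is itself the element
      \<open>h\<close> of the move if \<open>e\<close> is a backward one. In both cases a cancelling
      move with \<open>h\<close> equal to 1 applies and leaves \<open>g\<close> times its
      inverse.\<close>
    have cancel: "Step g e ?s \<simeq>\<^bsub>X\<^esub> Elt (oini X e) \<one>\<^bsub>grp X (oini X e)\<^esub>"
      using e
    proof (cases rule: oedge_cases)
      case (1 a)
      then show ?thesis
        using homotopic_cancel_fwd[of a g "\<one>\<^bsub>grp X (ini X a)\<^esub>" "Elt (ini X a) ?g"] g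
        by (simp add: i_def ini_closed)
    next
      case (2 a)
      then show ?thesis
        using homotopic_cancel_bwd[of a g "\<one>\<^bsub>grp X (ini X a)\<^esub>" "Elt (ter X a) ?g"] g
        by (simp add: i_def ini_closed ter_closed)
    qed
    have cancel': "Step \<one>\<^bsub>grp X (oter X e)\<^esub> i (Step \<one>\<^bsub>grp X (oini X e)\<^esub> e p) \<simeq>\<^bsub>X\<^esub> p"
      using e
    proof (cases rule: oedge_cases)
      case (1 a)
      then show ?thesis
        using homotopic_cancel_bwd[of a "\<one>\<^bsub>grp X (ter X a)\<^esub>" "\<one>\<^bsub>grp X (ini X a)\<^esub>" p] p
        by (simp add: i_def ini_closed ter_closed)
    next
      case (2 a)
      then show ?thesis
        using homotopic_cancel_fwd[of a "\<one>\<^bsub>grp X (ini X a)\<^esub>" "\<one>\<^bsub>grp X (ini X a)\<^esub>" p] p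
        by (simp add: i_def ini_closed ter_closed)
    qed
    \<comment> \<open>The inner pair \<open>p\<close>, \<open>q\<close> disappears first. What
      remains is \<open>e\<close> next to its inverse, which \<open>cancel\<close>
      contracts.\<close>
    have "pconcat X (pconcat X p q) ?s \<simeq>\<^bsub>X\<^esub> ?s"
      using homotopic_pconcat_right[OF q(4), of ?s] p q e i s by simp
    then have "Step g e (pconcat X (pconcat X p q) ?s) \<simeq>\<^bsub>X\<^esub> Step g e ?s"
      by (rule homotopic_Step) (use p q e i g in auto)
    then have 1: "Step g e (pconcat X p (pconcat X q ?s)) \<simeq>\<^bsub>X\<^esub> Elt (oini X e) \<one>\<^bsub>grp X (oini X e)\<^esub>"
      using p q s i cancel by (subst (asm) pconcat_assoc) (auto intro: homotopic_trans)
    have "pconcat X q (pconcat X ?s (Step g e p)) \<simeq>\<^bsub>X\<^esub> pconcat X q p"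
      by (rule homotopic_pconcat_left) (use cancel' p q e i g in auto)
    then have "pconcat X (pconcat X q ?s) (Step g e p) \<simeq>\<^bsub>X\<^esub> pconcat X q p"
      using p q e i g s by (subst pconcat_assoc) auto
    then have 2: "pconcat X (pconcat X q ?s) (Step g e p) \<simeq>\<^bsub>X\<^esub> Elt (pter p) \<one>\<^bsub>grp X (pter p)\<^esub>"
      using q(5) by (rule homotopic_trans)
    show ?case
      by (rule exI[of _ "pconcat X q ?s"]) (use 1 2 p q e i g s in auto)
  qed
  then show ?thesis using that by blast
qed

text \<open>Left cancellation in the fundamental groupoid: concatenate with a reverse of
  \<open>r\<close> on the left.\<close>

lemma homotopic_pconcat_cancel:
  assumes "is_path X r" "is_path X p" "is_path X q" "pter r = pini X p" "pter r = pini X q"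
    and "pconcat X r p \<simeq>\<^bsub>X\<^esub> pconcat X r q"
  shows "p \<simeq>\<^bsub>X\<^esub> q"
proof -
  obtain s where s: "is_path X s" "pini X s = pter r" "pter s = pini X r"
    "pconcat X s r \<simeq>\<^bsub>X\<^esub> Elt (pter r) \<one>\<^bsub>grp X (pter r)\<^esub>"
    using reverse_path_exists[OF assms(1)] by metis
  have *: "pconcat X s (pconcat X r t) \<simeq>\<^bsub>X\<^esub> t" if "is_path X t" "pter r = pini X t" for t
    using homotopic_pconcat_right[OF s(4), of t] that s assms(1) by (simp add: pconcat_assoc)
  have "p \<simeq>\<^bsub>X\<^esub> pconcat X s (pconcat X r p)" using * assms homotopic_sym by blast
  also have "\<dots> \<simeq>\<^bsub>X\<^esub> pconcat X s (pconcat X r q)"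
    using homotopic_pconcat_left[OF assms(6) s(1)] s assms by simp
  also have "\<dots> \<simeq>\<^bsub>X\<^esub> q" using * assms by blast
  finally show ?thesis .
qed

text \<open>Both paths are the edge path of \<open>a\<close> followed by a tail. Cancelling the edge
  turns a relation between paths through \<open>a\<close> into one at the end vertex of
  \<open>a\<close>.\<close>

lemma homotopic_Fwd_cancel:
  assumes "a \<in> edges X" "is_path X p" "is_path X q" "pini X p = ter X a" "pini X q = ter X a"
    and "Step \<one>\<^bsub>grp X (ini X a)\<^esub> (Fwd a) p \<simeq>\<^bsub>X\<^esub> Step \<one>\<^bsub>grp X (ini X a)\<^esub> (Fwd a) q"
  shows "p \<simeq>\<^bsub>X\<^esub> q"
  by (rule homotopic_pconcat_cancel[of "edge_path X (Fwd a)"])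
    (use assms in \<open>auto simp: edge_path_def ini_closed ter_closed\<close>)

text \<open>A path of the underlying scwol becomes a path of the complex when units are inserted at
  all vertices.\<close>

lemma path_exists:
  assumes "\<sigma> \<in> verts X" "\<tau> \<in> verts X"
  obtains p where "is_path X p" "pini X p = \<sigma>" "pter p = \<tau>"
proof -
  obtain es where "scwol_path X \<sigma> es \<tau>" using connected assms by blast
  then have "\<exists>p. is_path X p \<and> pini X p = \<sigma> \<and> pter p = \<tau>" using assms(1)
  proof (induction es arbitrary: \<sigma>)
    case Nil
    then show ?case by (intro exI[of _ "Elt \<sigma> \<one>\<^bsub>grp X \<sigma>\<^esub>"]) auto
  next
    case (Cons e es)
    then obtain p where "is_path X p" "pini X p = oter X e" "pter p = \<tau>"
      using Cons.IH[of "oter X e"] by fastforce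
    then show ?case using Cons.prems by (intro exI[of _ "Step \<one>\<^bsub>grp X \<sigma>\<^esub> e p"]) auto
  qed
  then show ?thesis using that by blast
qed

section \<open>Homotopy classes and vertices of the universal complex\<close>

lemma homotopy_class_eq_iff:
  assumes "is_path X p" "is_path X q"
  shows "homotopy_class X p = homotopy_class X q \<longleftrightarrow> p \<simeq>\<^bsub>X\<^esub> q"
proof
  assume "homotopy_class X p = homotopy_class X q"
  moreover have "q \<in> homotopy_class X q"
    using homotopic_refl[OF assms(2)] by (simp add: homotopy_class_def homotopic_def)
  ultimately have "q \<in> homotopy_class X p" by simp
  then show "p \<simeq>\<^bsub>X\<^esub> q" by (simp add: homotopy_class_def homotopic_def)
next
  assume "p \<simeq>\<^bsub>X\<^esub> q"
  then show "homotopy_class X p = homotopy_class X q"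
    unfolding homotopy_class_def Image_singleton homotopic_def[symmetric]
    by (auto intro: homotopic_trans homotopic_sym)
qed

lemma universal_class_iff:
  assumes "is_path X p"
  shows "q \<in> universal_class X \<sigma>\<^sub>0 p \<longleftrightarrow> pini X q = \<sigma>\<^sub>0 \<and>
    (\<exists>g\<in>carrier (grp X (pter p)). q \<simeq>\<^bsub>X\<^esub> pconcat X p (Elt (pter p) g))"
  using assms homotopic_ends homotopy_class_eq_iff
  by (auto simp: universal_class_def paths_from_def)

lemma universal_class_self:
  assumes "is_path X p"
  shows "p \<in> universal_class X (pini X p) p"
  unfolding universal_class_iff[OF assms] using assms by (auto intro!: bexI[of _ "\<one>\<^bsub>grp X (pter p)\<^esub>"])

text \<open>Elements appended at the end vertex multiply: if \<open>r\<close> is \<open>p\<close>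
  followed by \<open>h\<close>, then it is \<open>q\<close> followed by the product of
  \<open>g\<close> and \<open>h\<close>.\<close>

lemma universal_class_subset:
  assumes "p \<simeq>\<^bsub>X\<^esub> pconcat X q (Elt (pter q) g)" "is_path X q" "g \<in> carrier (grp X (pter q))"
  shows "universal_class X \<sigma>\<^sub>0 p \<subseteq> universal_class X \<sigma>\<^sub>0 q"
proof
  fix r assume r: "r \<in> universal_class X \<sigma>\<^sub>0 p"
  note ends = homotopic_ends[OF assms(1)]
  obtain h where h: "h \<in> carrier (grp X (pter q))" "r \<simeq>\<^bsub>X\<^esub> pconcat X p (Elt (pter q) h)"
    using r ends by (auto simp: universal_class_iff)
  note h(2)
  also have "pconcat X p (Elt (pter q) h) \<simeq>\<^bsub>X\<^esub> pconcat X (pconcat X q (Elt (pter q) g)) (Elt (pter q) h)"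
    by (rule homotopic_pconcat_right) (use assms ends h in auto)
  also have "\<dots> = pconcat X q (Elt (pter q) (g \<otimes>\<^bsub>grp X (pter q)\<^esub> h))"
    using assms h by (simp add: pconcat_assoc)
  finally show "r \<in> universal_class X \<sigma>\<^sub>0 q"
    using r h assms ends by (auto simp: universal_class_iff)
qed

text \<open>The hypothesis can be reversed by appending the inverse of \<open>g\<close>, so the
  inclusion holds both ways.\<close>

lemma universal_class_eq:
  assumes "p \<simeq>\<^bsub>X\<^esub> pconcat X q (Elt (pter q) g)" "is_path X q" "g \<in> carrier (grp X (pter q))"
  shows "universal_class X \<sigma>\<^sub>0 p = universal_class X \<sigma>\<^sub>0 q"
proof
  show "universal_class X \<sigma>\<^sub>0 p \<subseteq> universal_class X \<sigma>\<^sub>0 q"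
    using assms by (rule universal_class_subset)
  note ends = homotopic_ends[OF assms(1)]
  let ?h = "Elt (pter q) (inv\<^bsub>grp X (pter q)\<^esub> g)"
  have "pconcat X p ?h \<simeq>\<^bsub>X\<^esub> pconcat X (pconcat X q (Elt (pter q) g)) ?h"
    by (rule homotopic_pconcat_right) (use assms ends in auto)
  also have "\<dots> = q" using assms by (simp add: pconcat_assoc)
  finally have "q \<simeq>\<^bsub>X\<^esub> pconcat X p (Elt (pter p) (inv\<^bsub>grp X (pter q)\<^esub> g))"
    using ends homotopic_sym by simp
  then show "universal_class X \<sigma>\<^sub>0 q \<subseteq> universal_class X \<sigma>\<^sub>0 p"
    by (rule universal_class_subset) (use ends assms in auto)
qed

end


section \<open>Induced maps\<close>

context complex_morphism
begin

declare vmap_closed [simp]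

text \<open>Endpoints of image edges are rewritten to images of endpoints, which gives the local
  groups of the target at such vertices one normal form, \<open>grp Y (vmap f _)\<close>.\<close>

lemma edge_simps [simp]:
  assumes "a \<in> edges X"
  shows "ini X a \<in> verts X" "ter X a \<in> verts X" "emap f a \<in> edges Y"
    "ini Y (emap f a) = vmap f (ini X a)" "ter Y (emap f a) = vmap f (ter X a)"
    "elt \<phi> a \<in> carrier (grp Y (vmap f (ter X a)))"
  using assms
  by (auto simp: source.ini_closed source.ter_closed emap_closed ini_emap ter_emap elt_closed)

text \<open>\<open>target.psi_closed\<close> mentions the endpoints of \<open>emap f a\<close>,
  which the simplifier has already rewritten, so closure is restated in the normal form.\<close>

lemma psi_image_closed [simp]:
  "\<lbrakk>a \<in> edges X; g \<in> carrier (grp Y (vmap f (ini X a)))\<rbrakk> \<Longrightarrow>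
    psi Y (emap f a) g \<in> carrier (grp Y (vmap f (ter X a)))"
  using target.psi_closed[of "emap f a" g] by simp

lemma loc_closed [simp]:
  "\<lbrakk>\<sigma> \<in> verts X; g \<in> carrier (grp X \<sigma>)\<rbrakk> \<Longrightarrow> loc \<phi> \<sigma> g \<in> carrier (grp Y (vmap f \<sigma>))"
  using loc_hom by (auto simp: hom_def)

lemma loc_mult [simp]:
  "\<lbrakk>\<sigma> \<in> verts X; g \<in> carrier (grp X \<sigma>); h \<in> carrier (grp X \<sigma>)\<rbrakk> \<Longrightarrow>
    loc \<phi> \<sigma> (g \<otimes>\<^bsub>grp X \<sigma>\<^esub> h) = loc \<phi> \<sigma> g \<otimes>\<^bsub>grp Y (vmap f \<sigma>)\<^esub> loc \<phi> \<sigma> h"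
  using loc_hom by (auto simp: hom_def)

lemma loc_group_hom: "\<sigma> \<in> verts X \<Longrightarrow> group_hom (grp X \<sigma>) (grp Y (vmap f \<sigma>)) (loc \<phi> \<sigma>)"
  by (simp add: group_hom_def group_hom_axioms_def source.group_grp target.group_grp loc_hom)

lemma loc_one [simp]: "\<sigma> \<in> verts X \<Longrightarrow> loc \<phi> \<sigma> \<one>\<^bsub>grp X \<sigma>\<^esub> = \<one>\<^bsub>grp Y (vmap f \<sigma>)\<^esub>"
  using loc_group_hom group_hom.hom_one by blast

lemma loc_inv:
  "\<lbrakk>\<sigma> \<in> verts X; g \<in> carrier (grp X \<sigma>)\<rbrakk> \<Longrightarrow>
    loc \<phi> \<sigma> (inv\<^bsub>grp X \<sigma>\<^esub> g) = inv\<^bsub>grp Y (vmap f \<sigma>)\<^esub> loc \<phi> \<sigma> g"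
  using loc_group_hom group_hom.hom_inv by metis

text \<open>The conjugation axiom multiplied by \<phi>(a) on the right, which removes the inverse
  hidden in \<open>conj_by\<close>.\<close>

lemma elt_commute:
  assumes "a \<in> edges X" "g \<in> carrier (grp X (ini X a))"
  shows "loc \<phi> (ter X a) (psi X a g) \<otimes>\<^bsub>grp Y (vmap f (ter X a))\<^esub> elt \<phi> a
    = elt \<phi> a \<otimes>\<^bsub>grp Y (vmap f (ter X a))\<^esub> psi Y (emap f a) (loc \<phi> (ini X a) g)"
proof -
  interpret G: group "grp Y (vmap f (ter X a))" using assms by (simp add: target.group_grp)
  have "psi Y (emap f a) (loc \<phi> (ini X a) g) \<in> carrier (grp Y (vmap f (ter X a)))"
    "elt \<phi> a \<in> carrier (grp Y (vmap f (ter X a)))" using assms by auto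
  then show ?thesis
    by (simp add: elt_conj[OF assms, symmetric] conj_by_def G.m_assoc)
qed

lemma path_map_ends:
  assumes "is_path X p"
  shows "is_path Y (path_map X Y f \<phi> p) \<and> pini Y (path_map X Y f \<phi> p) = vmap f (pini X p)
    \<and> pter (path_map X Y f \<phi> p) = vmap f (pter p)"
  using assms by (induction p) (auto elim!: source.oedge_cases)

lemma is_path_path_map [simp]: "is_path X p \<Longrightarrow> is_path Y (path_map X Y f \<phi> p)"
  and pini_path_map [simp]: "is_path X p \<Longrightarrow> pini Y (path_map X Y f \<phi> p) = vmap f (pini X p)"
  and pter_path_map [simp]: "is_path X p \<Longrightarrow> pter (path_map X Y f \<phi> p) = vmap f (pter p)"
  using path_map_ends by auto

text \<open>This and \<open>path_map_Bwd\<close> take the place of the general recursion equation in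
  the simplifier. The units from \<open>edge_image\<close> are gone: \<phi>(a) appears inverted
  after a forward edge, and uninverted before a backward one.\<close>

lemma path_map_Fwd [simp]:
  "\<lbrakk>a \<in> edges X; g \<in> carrier (grp X (ini X a)); is_path X p; pini X p = ter X a\<rbrakk> \<Longrightarrow>
    path_map X Y f \<phi> (Step g (Fwd a) p) = Step (loc \<phi> (ini X a) g) (Fwd (emap f a))
      (left_mult Y (inv\<^bsub>grp Y (vmap f (ter X a))\<^esub> elt \<phi> a) (path_map X Y f \<phi> p))"
  by simp

lemma path_map_Bwd [simp]:
  "\<lbrakk>a \<in> edges X; g \<in> carrier (grp X (ter X a)); is_path X p; pini X p = ini X a\<rbrakk> \<Longrightarrow>
    path_map X Y f \<phi> (Step g (Bwd a) p) =
      Step (loc \<phi> (ter X a) g \<otimes>\<^bsub>grp Y (vmap f (ter X a))\<^esub> elt \<phi> a) (Bwd (emap f a))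
        (path_map X Y f \<phi> p)"
  by simp

declare path_map.simps(2) [simp del]

lemma path_map_left_mult:
  assumes "is_path X p" "g \<in> carrier (grp X (pini X p))"
  shows "path_map X Y f \<phi> (left_mult X g p)
    = left_mult Y (loc \<phi> (pini X p) g) (path_map X Y f \<phi> p)"
  using assms by (cases p) (auto elim!: source.oedge_cases simp: target.grp_assoc)

lemma path_map_pconcat:
  "\<lbrakk>is_path X p; is_path X q; pter p = pini X q\<rbrakk> \<Longrightarrow>
    path_map X Y f \<phi> (pconcat X p q) = pconcat Y (path_map X Y f \<phi> p) (path_map X Y f \<phi> q)"
  by (induction p)
    (auto elim!: source.oedge_cases simp: path_map_left_mult target.pconcat_left_mult)

section \<open>Path images respect homotopy\<close>

lemma elt_inv_commute:
  assumes "a \<in> edges X" "g \<in> carrier (grp X (ini X a))"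
  shows "inv\<^bsub>grp Y (vmap f (ter X a))\<^esub> elt \<phi> a \<otimes>\<^bsub>grp Y (vmap f (ter X a))\<^esub> loc \<phi> (ter X a) (psi X a g)
    = psi Y (emap f a) (loc \<phi> (ini X a) g)
        \<otimes>\<^bsub>grp Y (vmap f (ter X a))\<^esub> inv\<^bsub>grp Y (vmap f (ter X a))\<^esub> elt \<phi> a"
proof -
  interpret G: group "grp Y (vmap f (ter X a))" using assms by (simp add: target.group_grp)
  let ?G = "grp Y (vmap f (ter X a))"
  let ?x = "elt \<phi> a" and ?y = "psi Y (emap f a) (loc \<phi> (ini X a) g)"
    and ?z = "loc \<phi> (ter X a) (psi X a g)"
  have *: "?x \<in> carrier ?G" "?y \<in> carrier ?G" "?z \<in> carrier ?G" using assms by auto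
  have "?z = ?x \<otimes>\<^bsub>?G\<^esub> (?y \<otimes>\<^bsub>?G\<^esub> inv\<^bsub>?G\<^esub> ?x)"
    using elt_commute[OF assms] * by (metis G.inv_closed G.m_assoc G.r_inv G.r_one)
  then show ?thesis using * assms by simp
qed

text \<open>In the sliding and cancelling moves the twisting elements are moved out of the way by
  the conjugation axiom. In the composing moves they combine through
  \<open>elt_twist\<close>.\<close>

lemma path_map_elementary:
  assumes "elementary X s s'"
  shows "path_map X Y f \<phi> s \<simeq>\<^bsub>Y\<^esub> path_map X Y f \<phi> s'"
  using assms
proof cases
  case (slide_fwd a k g h)
  let ?G = "grp Y (vmap f (ter X a))"
  have "psi Y (emap f a) (loc \<phi> (ini X a) g) \<otimes>\<^bsub>?G\<^esub> (inv\<^bsub>?G\<^esub> elt \<phi> a \<otimes>\<^bsub>?G\<^esub> loc \<phi> (ter X a) h)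
      = inv\<^bsub>?G\<^esub> elt \<phi> a \<otimes>\<^bsub>?G\<^esub> (loc \<phi> (ter X a) (psi X a g) \<otimes>\<^bsub>?G\<^esub> loc \<phi> (ter X a) h)"
    using slide_fwd by (simp add: target.grp_assoc[symmetric] elt_inv_commute)
  then show ?thesis
    using target.homotopic_slide_fwd[of "emap f a" "loc \<phi> (ini X a) k" "loc \<phi> (ini X a) g"
      "Elt (vmap f (ter X a)) (inv\<^bsub>?G\<^esub> elt \<phi> a \<otimes>\<^bsub>?G\<^esub> loc \<phi> (ter X a) h)"] slide_fwd
    by simp
next
  case (slide_bwd a g h k)
  then show ?thesis
    using target.homotopic_slide_bwd[of "emap f a"
      "loc \<phi> (ter X a) g \<otimes>\<^bsub>grp Y (vmap f (ter X a))\<^esub> elt \<phi> a" "loc \<phi> (ini X a) h"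
      "Elt (vmap f (ini X a)) (loc \<phi> (ini X a) k)"]
    by (simp add: target.grp_assoc elt_commute)
next
  case (cancel_fwd a g h k)
  then show ?thesis
    using target.homotopic_cancel_fwd[of "emap f a" "loc \<phi> (ini X a) g" "loc \<phi> (ini X a) h"
      "Elt (vmap f (ini X a)) (loc \<phi> (ini X a) k)"]
    by (simp add: elt_commute)
next
  case (cancel_bwd a g h k)
  let ?G = "grp Y (vmap f (ter X a))"
  show ?thesis
    using target.homotopic_cancel_bwd[of "emap f a"
      "loc \<phi> (ter X a) g \<otimes>\<^bsub>?G\<^esub> elt \<phi> a" "loc \<phi> (ini X a) h"
      "Elt (vmap f (ter X a)) (inv\<^bsub>?G\<^esub> elt \<phi> a \<otimes>\<^bsub>?G\<^esub> loc \<phi> (ter X a) k)"] cancel_bwd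
    \<comment> \<open>The reversed instance of associativity brings \<phi>(a) next to the
      \<open>psi\<close> factor. After they commute, \<phi>(a) meets its inverse.\<close>
    by (simp add: target.grp_assoc target.grp_inv_mult_cancel
        elt_commute[symmetric]
        target.grp_assoc[of _ "elt \<phi> a" "psi Y (emap f a) (loc \<phi> (ini X a) h)", symmetric])
next
  case (compose_fwd a b g k)
  note ab = source.edges2D[OF compose_fwd(3)]
  let ?G = "grp Y (vmap f (ter X a))" and ?H = "grp Y (vmap f (ini X a))"
  let ?ab = "cmp X a b"
  have fab: "(emap f a, emap f b) \<in> edges2 Y" using ab by (simp add: edges2_def)
  have c: "?ab \<in> edges X" "ini X ?ab = ini X b" "ter X ?ab = ter X a"
    "emap f ?ab = cmp Y (emap f a) (emap f b)"
    using compose_fwd(3) by (auto simp: source.cmp_closed source.ini_cmp source.ter_cmp emap_cmp)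
  have tw: "twist X a b \<in> carrier (grp X (ter X a))" "twist Y (emap f a) (emap f b) \<in> carrier ?G"
    using source.twist_closed[OF compose_fwd(3)] target.twist_closed[OF fab] ab by auto
  have el: "elt \<phi> a \<in> carrier ?G" "elt \<phi> b \<in> carrier ?H" "elt \<phi> ?ab \<in> carrier ?G"
    using edge_simps(6)[of b] edge_simps(6)[of ?ab] ab c by auto
  let ?k = "inv\<^bsub>?G\<^esub> elt \<phi> a \<otimes>\<^bsub>?G\<^esub> loc \<phi> (ter X a) k"
  let ?p = "psi Y (emap f a) (elt \<phi> b)"
  have p: "?p \<in> carrier ?G" using ab el by simp
  have "path_map X Y f \<phi> s = Step (loc \<phi> (ini X b) g) (Fwd (emap f b))
      (Step (inv\<^bsub>?H\<^esub> elt \<phi> b) (Fwd (emap f a)) (Elt (vmap f (ter X a)) ?k))"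
    using compose_fwd ab el by simp
  \<comment> \<open>The composing move wants a unit between the two edges, but the image has the
    inverse of \<phi>(b) there. It is first slid across \<open>f(a)\<close>.\<close>
  also have "\<dots> \<simeq>\<^bsub>Y\<^esub> Step (loc \<phi> (ini X b) g) (Fwd (emap f b))
      (Step \<one>\<^bsub>?H\<^esub> (Fwd (emap f a)) (Elt (vmap f (ter X a)) (inv\<^bsub>?G\<^esub> ?p \<otimes>\<^bsub>?G\<^esub> ?k)))"
    by (rule target.homotopic_Step)
      (use target.homotopic_slide_fwd[of "emap f a" "\<one>\<^bsub>?H\<^esub>" "inv\<^bsub>?H\<^esub> elt \<phi> b" "Elt (vmap f (ter X a)) ?k"]
        target.psi_inv[of "emap f a" "elt \<phi> b"] ab el compose_fwd in auto)
  also have "\<dots> \<simeq>\<^bsub>Y\<^esub> Step (loc \<phi> (ini X b) g) (Fwd (cmp Y (emap f a) (emap f b)))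
      (Elt (vmap f (ter X a)) (inv\<^bsub>?G\<^esub> twist Y (emap f a) (emap f b) \<otimes>\<^bsub>?G\<^esub> (inv\<^bsub>?G\<^esub> ?p \<otimes>\<^bsub>?G\<^esub> ?k)))"
    using target.elementary_homotopic[OF elementary.compose_fwd[OF fab,
        of "loc \<phi> (ini X b) g" "inv\<^bsub>?G\<^esub> ?p \<otimes>\<^bsub>?G\<^esub> ?k"]]
      ab el p compose_fwd by simp
  \<comment> \<open>The three collected inverses form the inverse of the right side of
    \<open>elt_twist\<close>, which the next step replaces by its left side.\<close>
  also have "inv\<^bsub>?G\<^esub> twist Y (emap f a) (emap f b) \<otimes>\<^bsub>?G\<^esub> (inv\<^bsub>?G\<^esub> ?p \<otimes>\<^bsub>?G\<^esub> ?k)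
      = inv\<^bsub>?G\<^esub> (elt \<phi> a \<otimes>\<^bsub>?G\<^esub> ?p \<otimes>\<^bsub>?G\<^esub> twist Y (emap f a) (emap f b)) \<otimes>\<^bsub>?G\<^esub> loc \<phi> (ter X a) k"
    using ab el p tw compose_fwd by (simp add: target.grp_inv_mult target.grp_assoc)
  also have "\<dots> = inv\<^bsub>?G\<^esub> elt \<phi> ?ab
      \<otimes>\<^bsub>?G\<^esub> (loc \<phi> (ter X a) (inv\<^bsub>grp X (ter X a)\<^esub> twist X a b) \<otimes>\<^bsub>?G\<^esub> loc \<phi> (ter X a) k)"
    unfolding elt_twist[OF compose_fwd(3), symmetric] using ab el tw compose_fwd(5)
    by (simp add: target.grp_inv_mult target.grp_assoc loc_inv)
  also have "Step (loc \<phi> (ini X b) g) (Fwd (cmp Y (emap f a) (emap f b))) (Elt (vmap f (ter X a)) \<dots>)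
      = path_map X Y f \<phi> s'"
    using compose_fwd ab tw c by simp
  finally show ?thesis .
next
  case (compose_bwd a b g k)
  note ab = source.edges2D[OF compose_bwd(3)]
  let ?G = "grp Y (vmap f (ter X a))" and ?H = "grp Y (vmap f (ini X a))"
  let ?ab = "cmp X a b"
  have fab: "(emap f a, emap f b) \<in> edges2 Y" using ab by (simp add: edges2_def)
  have c: "?ab \<in> edges X" "ini X ?ab = ini X b" "ter X ?ab = ter X a"
    "emap f ?ab = cmp Y (emap f a) (emap f b)"
    using compose_bwd(3) by (auto simp: source.cmp_closed source.ini_cmp source.ter_cmp emap_cmp)
  have tw: "twist X a b \<in> carrier (grp X (ter X a))" "twist Y (emap f a) (emap f b) \<in> carrier ?G"
    using source.twist_closed[OF compose_bwd(3)] target.twist_closed[OF fab] ab by auto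
  have el: "elt \<phi> a \<in> carrier ?G" "elt \<phi> b \<in> carrier ?H" "elt \<phi> ?ab \<in> carrier ?G"
    using edge_simps(6)[of b] edge_simps(6)[of ?ab] ab c by auto
  let ?k = "Elt (vmap f (ini X b)) (loc \<phi> (ini X b) k)"
  let ?p = "psi Y (emap f a) (elt \<phi> b)" and ?g = "loc \<phi> (ter X a) g"
  have p: "?p \<in> carrier ?G" using ab el by simp
  have "path_map X Y f \<phi> s = Step (?g \<otimes>\<^bsub>?G\<^esub> elt \<phi> a) (Bwd (emap f a))
      (left_mult Y (elt \<phi> b) (Step \<one>\<^bsub>?H\<^esub> (Bwd (emap f b)) ?k))"
    using compose_bwd ab el by simp
  \<comment> \<open>Mirror image of the forward case: \<phi>(b) stands before the second edge and
    moves left across the first, leaving a unit between them.\<close>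
  also have "\<dots> \<simeq>\<^bsub>Y\<^esub> Step (?g \<otimes>\<^bsub>?G\<^esub> elt \<phi> a \<otimes>\<^bsub>?G\<^esub> ?p) (Bwd (emap f a)) (Step \<one>\<^bsub>?H\<^esub> (Bwd (emap f b)) ?k)"
    using target.homotopic_slide_bwd[of "emap f a" "?g \<otimes>\<^bsub>?G\<^esub> elt \<phi> a" "elt \<phi> b"
        "Step \<one>\<^bsub>?H\<^esub> (Bwd (emap f b)) ?k"]
      ab el compose_bwd by simp
  also have "\<dots> \<simeq>\<^bsub>Y\<^esub> Step (?g \<otimes>\<^bsub>?G\<^esub> elt \<phi> a \<otimes>\<^bsub>?G\<^esub> ?p \<otimes>\<^bsub>?G\<^esub> twist Y (emap f a) (emap f b))
      (Bwd (cmp Y (emap f a) (emap f b))) ?k"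
    using target.elementary_homotopic[OF elementary.compose_bwd[OF fab,
        of "?g \<otimes>\<^bsub>?G\<^esub> elt \<phi> a \<otimes>\<^bsub>?G\<^esub> ?p" "loc \<phi> (ini X b) k"]]
      ab el p compose_bwd by simp
  also have "?g \<otimes>\<^bsub>?G\<^esub> elt \<phi> a \<otimes>\<^bsub>?G\<^esub> ?p \<otimes>\<^bsub>?G\<^esub> twist Y (emap f a) (emap f b)
      = ?g \<otimes>\<^bsub>?G\<^esub> (elt \<phi> a \<otimes>\<^bsub>?G\<^esub> ?p \<otimes>\<^bsub>?G\<^esub> twist Y (emap f a) (emap f b))"
    using ab el p tw compose_bwd by (simp add: target.grp_assoc)
  also have "\<dots> = ?g \<otimes>\<^bsub>?G\<^esub> loc \<phi> (ter X a) (twist X a b) \<otimes>\<^bsub>?G\<^esub> elt \<phi> ?ab"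
    unfolding elt_twist[OF compose_bwd(3), symmetric] using ab el tw compose_bwd(4)
    by (simp add: target.grp_assoc)
  also have "Step \<dots> (Bwd (cmp Y (emap f a) (emap f b))) ?k = path_map X Y f \<phi> s'"
    using compose_bwd ab tw c by simp
  finally show ?thesis .
qed

text \<open>\<open>path_map\<close> is multiplicative, so the image of a replacement is the image of
  its elementary move in the image context.\<close>

lemma path_map_homotopic:
  assumes "p \<simeq>\<^bsub>X\<^esub> q"
  shows "path_map X Y f \<phi> p \<simeq>\<^bsub>Y\<^esub> path_map X Y f \<phi> q"
proof (rule source.homotopic_map[OF assms])
  fix u v assume "replace_subpath X u v"
  then show "path_map X Y f \<phi> u \<simeq>\<^bsub>Y\<^esub> path_map X Y f \<phi> v"
  proof cases
    case (1 s s' r r')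
    note el = source.elementary_paths[OF 1(3)]
    have "pconcat Y (path_map X Y f \<phi> s) (path_map X Y f \<phi> r') \<simeq>\<^bsub>Y\<^esub>
      pconcat Y (path_map X Y f \<phi> s') (path_map X Y f \<phi> r')"
      by (rule target.homotopic_pconcat_right) (use 1 el path_map_elementary in auto)
    then have "pconcat Y (path_map X Y f \<phi> r) (pconcat Y (path_map X Y f \<phi> s) (path_map X Y f \<phi> r')) \<simeq>\<^bsub>Y\<^esub>
      pconcat Y (path_map X Y f \<phi> r) (pconcat Y (path_map X Y f \<phi> s') (path_map X Y f \<phi> r'))"
      by (rule target.homotopic_pconcat_left) (use 1 el in auto)
    then show ?thesis using 1 el by (simp add: path_map_pconcat)
  qed
qed (use assms source.homotopic_ends target.complex_of_groups_axioms in auto)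

end

section \<open>A homotopy forces equal induced maps\<close>

locale morphism_pair = source: complex_of_groups X + target: complex_of_groups Y +
  first: complex_morphism X Y f \<phi> + second: complex_morphism X Y f \<eta>
  for X :: "('v, 'e, 'g) group_complex" and Y :: "('w, 'd, 'h) group_complex"
    and f :: "('v, 'e, 'w, 'd) scwol_map" and \<phi> \<eta> :: "('v, 'e, 'g, 'h) complex_map"
begin

text \<open>Inverse-free forms of the homotopy equations: \<open>k\<close> commutes with the local
  maps and with the edge elements like a natural transformation.\<close>

lemma is_homotopyD:
  assumes "is_homotopy X Y f \<phi> \<eta> k"
  shows "\<sigma> \<in> verts X \<Longrightarrow> k \<sigma> \<in> carrier (grp Y (vmap f \<sigma>))"
    and "\<lbrakk>\<sigma> \<in> verts X; g \<in> carrier (grp X \<sigma>)\<rbrakk> \<Longrightarrow>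
      loc \<eta> \<sigma> g \<otimes>\<^bsub>grp Y (vmap f \<sigma>)\<^esub> k \<sigma> = k \<sigma> \<otimes>\<^bsub>grp Y (vmap f \<sigma>)\<^esub> loc \<phi> \<sigma> g"
    and "a \<in> edges X \<Longrightarrow> elt \<eta> a \<otimes>\<^bsub>grp Y (vmap f (ter X a))\<^esub> psi Y (emap f a) (k (ini X a))
      = k (ter X a) \<otimes>\<^bsub>grp Y (vmap f (ter X a))\<^esub> elt \<phi> a"
proof -
  show closed: "k \<sigma> \<in> carrier (grp Y (vmap f \<sigma>))" if "\<sigma> \<in> verts X" for \<sigma>
    using assms that by (simp add: is_homotopy_def)
  show "loc \<eta> \<sigma> g \<otimes>\<^bsub>grp Y (vmap f \<sigma>)\<^esub> k \<sigma> = k \<sigma> \<otimes>\<^bsub>grp Y (vmap f \<sigma>)\<^esub> loc \<phi> \<sigma> g"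
    if "\<sigma> \<in> verts X" "g \<in> carrier (grp X \<sigma>)"
    using assms that closed by (simp add: is_homotopy_def conj_by_def target.grp_assoc)
  show "elt \<eta> a \<otimes>\<^bsub>grp Y (vmap f (ter X a))\<^esub> psi Y (emap f a) (k (ini X a))
      = k (ter X a) \<otimes>\<^bsub>grp Y (vmap f (ter X a))\<^esub> elt \<phi> a" if "a \<in> edges X"
    using assms that closed target.psi_inv[of "emap f a" "k (ini X a)"]
    by (simp add: is_homotopy_def target.grp_assoc)
qed

text \<open>The start vertex is arbitrary because the tails met in the induction do not start at the
  base vertex. The factor at the end stays fixed; the leading factor of the tail is carried across
  the first edge and becomes the leading factor of the whole path.\<close>

lemma homotopy_path_map:
  assumes "is_homotopy X Y f \<phi> \<eta> k" "is_path X p"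
  shows "path_map X Y f \<eta> p \<simeq>\<^bsub>Y\<^esub> left_mult Y (k (pini X p)) (pconcat Y (path_map X Y f \<phi> p)
    (Elt (vmap f (pter p)) (inv\<^bsub>grp Y (vmap f (pter p))\<^esub> k (pter p))))"
  using assms(2)
proof (induction p)
  note k = is_homotopyD[OF assms(1)]
  case (Elt \<sigma> g)
  then show ?case using k(1)
    by (simp add: target.grp_assoc[symmetric] k(2)[symmetric]) (simp add: target.grp_assoc)
next
  note k = is_homotopyD[OF assms(1)]
  case (Step g e p)
  then have p: "is_path X p" "pini X p = oter X e" and e: "e \<in> oedges X"
    and g: "g \<in> carrier (grp X (oini X e))" by auto
  let ?K = "Elt (vmap f (pter p)) (inv\<^bsub>grp Y (vmap f (pter p))\<^esub> k (pter p))"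
  let ?R = "pconcat Y (path_map X Y f \<phi> p) ?K"
  have R: "is_path Y ?R" "pini Y ?R = vmap f (oter X e)" using p k(1) by auto
  have IH: "path_map X Y f \<eta> p \<simeq>\<^bsub>Y\<^esub> left_mult Y (k (oter X e)) ?R" using Step.IH p by simp
  show ?case using e
  proof (cases rule: source.oedge_cases)
    case (1 a)
    let ?G = "grp Y (vmap f (ter X a))" and ?H = "grp Y (vmap f (ini X a))"
    have eq: "inv\<^bsub>?G\<^esub> elt \<eta> a \<otimes>\<^bsub>?G\<^esub> k (ter X a) = psi Y (emap f a) (k (ini X a)) \<otimes>\<^bsub>?G\<^esub> inv\<^bsub>?G\<^esub> elt \<phi> a"
    proof -
      have "k (ter X a) = elt \<eta> a \<otimes>\<^bsub>?G\<^esub> psi Y (emap f a) (k (ini X a)) \<otimes>\<^bsub>?G\<^esub> inv\<^bsub>?G\<^esub> elt \<phi> a"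
        unfolding k(3)[OF 1(2)] using 1 k(1) by (simp add: target.grp_assoc)
      then show ?thesis using 1 k(1) by (simp add: target.grp_assoc)
    qed
    have "path_map X Y f \<eta> (Step g e p) = Step (loc \<eta> (ini X a) g) (Fwd (emap f a))
        (left_mult Y (inv\<^bsub>?G\<^esub> elt \<eta> a) (path_map X Y f \<eta> p))"
      using 1 g p by simp
    also have "\<dots> \<simeq>\<^bsub>Y\<^esub> Step (loc \<eta> (ini X a) g) (Fwd (emap f a))
        (left_mult Y (inv\<^bsub>?G\<^esub> elt \<eta> a) (left_mult Y (k (ter X a)) ?R))"
      by (intro target.homotopic_Step target.homotopic_left_mult) (use IH 1 g p k in auto)
    also have "left_mult Y (inv\<^bsub>?G\<^esub> elt \<eta> a) (left_mult Y (k (ter X a)) ?R)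
        = left_mult Y (psi Y (emap f a) (k (ini X a))) (left_mult Y (inv\<^bsub>?G\<^esub> elt \<phi> a) ?R)"
      using 1 p k(1) R eq by (simp add: target.left_mult_mult)
    \<comment> \<open>The sliding move is used from right to left, taking \<open>k\<close> from
      behind the forward edge to its front. There the vertex equation exchanges it with the local
      image of \<open>g\<close>.\<close>
    also have "Step (loc \<eta> (ini X a) g) (Fwd (emap f a)) \<dots> \<simeq>\<^bsub>Y\<^esub>
        Step (loc \<eta> (ini X a) g \<otimes>\<^bsub>?H\<^esub> k (ini X a)) (Fwd (emap f a)) (left_mult Y (inv\<^bsub>?G\<^esub> elt \<phi> a) ?R)"
      using target.homotopic_slide_fwd[of "emap f a" "loc \<eta> (ini X a) g" "k (ini X a)"
          "left_mult Y (inv\<^bsub>?G\<^esub> elt \<phi> a) ?R"]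
        1 g k(1) R by (auto intro: target.homotopic_sym)
    also have "\<dots> = left_mult Y (k (ini X a)) (pconcat Y (path_map X Y f \<phi> (Step g e p)) ?K)"
      using 1 g p k by (simp add: target.pconcat_left_mult)
    finally show ?thesis using 1 by simp
  next
    case (2 a)
    let ?G = "grp Y (vmap f (ter X a))"
    \<comment> \<open>Once \<open>k\<close> has crossed the backward edge, it passes \<eta>(a) by
      the edge equation and then the local image of \<open>g\<close> by the vertex equation.\<close>
    have eq: "loc \<eta> (ter X a) g \<otimes>\<^bsub>?G\<^esub> elt \<eta> a \<otimes>\<^bsub>?G\<^esub> psi Y (emap f a) (k (ini X a))
        = k (ter X a) \<otimes>\<^bsub>?G\<^esub> (loc \<phi> (ter X a) g \<otimes>\<^bsub>?G\<^esub> elt \<phi> a)"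
    proof -
      have "loc \<eta> (ter X a) g \<otimes>\<^bsub>?G\<^esub> elt \<eta> a \<otimes>\<^bsub>?G\<^esub> psi Y (emap f a) (k (ini X a))
          = loc \<eta> (ter X a) g \<otimes>\<^bsub>?G\<^esub> k (ter X a) \<otimes>\<^bsub>?G\<^esub> elt \<phi> a"
        using 2 g k(1) by (simp add: k(3) target.grp_assoc)
      then show ?thesis using 2 g k(1) by (simp add: k(2) target.grp_assoc)
    qed
    have "path_map X Y f \<eta> (Step g e p) = Step (loc \<eta> (ter X a) g \<otimes>\<^bsub>?G\<^esub> elt \<eta> a) (Bwd (emap f a))
        (path_map X Y f \<eta> p)"
      using 2 g p by simp
    also have "\<dots> \<simeq>\<^bsub>Y\<^esub> Step (loc \<eta> (ter X a) g \<otimes>\<^bsub>?G\<^esub> elt \<eta> a) (Bwd (emap f a)) (left_mult Y (k (ini X a)) ?R)"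
      by (intro target.homotopic_Step) (use IH 2 g p k in auto)
    also have "\<dots> \<simeq>\<^bsub>Y\<^esub> Step (loc \<eta> (ter X a) g \<otimes>\<^bsub>?G\<^esub> elt \<eta> a \<otimes>\<^bsub>?G\<^esub> psi Y (emap f a) (k (ini X a)))
        (Bwd (emap f a)) ?R"
      using target.homotopic_slide_bwd[of "emap f a" "loc \<eta> (ter X a) g \<otimes>\<^bsub>?G\<^esub> elt \<eta> a" "k (ini X a)" ?R]
        2 g k(1) R by simp
    also have "\<dots> = left_mult Y (k (ter X a)) (pconcat Y (path_map X Y f \<phi> (Step g e p)) ?K)"
      using 2 g p k eq by simp
    finally show ?thesis using 2 by simp
  qed
qed

lemma homotopic_rel_path_map:
  assumes "is_homotopy X Y f \<phi> \<eta> k" "k \<sigma>\<^sub>0 = \<one>\<^bsub>grp Y (vmap f \<sigma>\<^sub>0)\<^esub>"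
    and "is_path X p" "pini X p = \<sigma>\<^sub>0"
  shows "path_map X Y f \<eta> p \<simeq>\<^bsub>Y\<^esub> pconcat Y (path_map X Y f \<phi> p)
    (Elt (vmap f (pter p)) (inv\<^bsub>grp Y (vmap f (pter p))\<^esub> k (pter p)))"
  using homotopy_path_map[OF assms(1,3)] assms is_homotopyD(1)[OF assms(1)] by simp

lemma homotopic_rel_imp_pi1_map_eq:
  assumes "homotopic_rel X Y f \<phi> \<eta> \<sigma>\<^sub>0"
  shows "pi1_map X Y f \<phi> \<sigma>\<^sub>0 = pi1_map X Y f \<eta> \<sigma>\<^sub>0"
  unfolding pi1_map_def
proof (rule restrict_ext)
  obtain k where k: "is_homotopy X Y f \<phi> \<eta> k" "k \<sigma>\<^sub>0 = \<one>\<^bsub>grp Y (vmap f \<sigma>\<^sub>0)\<^esub>"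
    using assms by (auto simp: homotopic_rel_def)
  fix A assume "A \<in> carrier (pi1 X \<sigma>\<^sub>0)"
  then obtain l where l: "l \<in> loops_at X \<sigma>\<^sub>0" "A = homotopy_class X l"
    by (auto simp: pi1_def)
  have "homotopy_class Y (path_map X Y f \<phi> p) = homotopy_class Y (path_map X Y f \<eta> p)"
    if "p \<in> A" for p
  proof -
    have "l \<simeq>\<^bsub>X\<^esub> p" using that l by (simp add: homotopy_class_def homotopic_def)
    note ends = source.homotopic_ends[OF this]
    have p: "is_path X p" "pini X p = \<sigma>\<^sub>0" "pter p = \<sigma>\<^sub>0"
      using ends l by (auto simp: loops_at_def paths_from_def)
    \<comment> \<open>A loop also ends at the base vertex, so the last factor is the inverse of 1,
      which the group structure simplifies to 1.\<close>
    interpret G: group "grp Y (vmap f \<sigma>\<^sub>0)"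
      using p source.pini_closed[of p] by (simp add: target.group_grp)
    have "path_map X Y f \<eta> p \<simeq>\<^bsub>Y\<^esub> path_map X Y f \<phi> p"
      using homotopic_rel_path_map[OF k p(1,2)] p k(2) by simp
    then show ?thesis using p by (simp add: target.homotopy_class_eq_iff target.homotopic_sym)
  qed
  then show "(\<Union>p\<in>A. homotopy_class Y (path_map X Y f \<phi> p))
    = (\<Union>p\<in>A. homotopy_class Y (path_map X Y f \<eta> p))" by simp
qed

text \<open>At the base vertex \<open>k\<close> is trivial, so the images of a path differ by a
  group element at the end, which \<open>universal_class\<close> ignores. For the third component of
  an edge this element sits before \<open>f(a)\<close> and must first be slid across it.\<close>

lemma homotopic_rel_imp_universal_map_eq:
  assumes "homotopic_rel X Y f \<phi> \<eta> \<sigma>\<^sub>0"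
  shows "universal_map X Y f \<phi> \<sigma>\<^sub>0 \<tau>\<^sub>0 = universal_map X Y f \<eta> \<sigma>\<^sub>0 \<tau>\<^sub>0"
proof -
  obtain k where k: "is_homotopy X Y f \<phi> \<eta> k" "k \<sigma>\<^sub>0 = \<one>\<^bsub>grp Y (vmap f \<sigma>\<^sub>0)\<^esub>"
    using assms by (auto simp: homotopic_rel_def)
  have vertex: "universal_class Y \<tau>\<^sub>0 (path_map X Y f \<phi> p) = universal_class Y \<tau>\<^sub>0 (path_map X Y f \<eta> p)"
    if "is_path X p" "pini X p = \<sigma>\<^sub>0" for p
    by (rule target.universal_class_eq[symmetric])
      (use that homotopic_rel_path_map[OF k that] is_homotopyD(1)[OF k(1)] in auto)
  have edge: "universal_class Y \<tau>\<^sub>0 (pconcat Y (path_map X Y f \<phi> p) (edge_path Y (Fwd (emap f a))))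
      = universal_class Y \<tau>\<^sub>0 (pconcat Y (path_map X Y f \<eta> p) (edge_path Y (Fwd (emap f a))))"
    if p: "is_path X p" "pini X p = \<sigma>\<^sub>0" and a: "a \<in> edges X" "ini X a = pter p" for p a
  proof (rule target.universal_class_eq[symmetric])
    let ?E = "edge_path Y (Fwd (emap f a))"
    let ?k = "inv\<^bsub>grp Y (vmap f (ini X a))\<^esub> k (ini X a)"
    have E: "?E = Step \<one>\<^bsub>grp Y (vmap f (ini X a))\<^esub> (Fwd (emap f a))
        (Elt (vmap f (ter X a)) \<one>\<^bsub>grp Y (vmap f (ter X a))\<^esub>)"
      using a by (simp add: edge_path_def)
    have kc: "?k \<in> carrier (grp Y (vmap f (ini X a)))"
      using is_homotopyD(1)[OF k(1)] p a by simp
    have slide: "left_mult Y ?k ?E \<simeq>\<^bsub>Y\<^esub> pconcat Y ?E (Elt (vmap f (ter X a)) (psi Y (emap f a) ?k))"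
      using target.homotopic_slide_fwd[of "emap f a" "\<one>\<^bsub>grp Y (vmap f (ini X a))\<^esub>" ?k
          "Elt (vmap f (ter X a)) \<one>\<^bsub>grp Y (vmap f (ter X a))\<^esub>"] kc a(1) E by simp
    have "pconcat Y (path_map X Y f \<eta> p) ?E \<simeq>\<^bsub>Y\<^esub>
        pconcat Y (pconcat Y (path_map X Y f \<phi> p) (Elt (vmap f (pter p)) ?k)) ?E"
      by (rule target.homotopic_pconcat_right)
        (use homotopic_rel_path_map[OF k p] p a E in auto)
    also have "\<dots> = pconcat Y (path_map X Y f \<phi> p) (left_mult Y ?k ?E)"
      using p a kc by (simp add: target.pconcat_assoc E)
    also have "\<dots> \<simeq>\<^bsub>Y\<^esub> pconcat Y (path_map X Y f \<phi> p)
        (pconcat Y ?E (Elt (vmap f (ter X a)) (psi Y (emap f a) ?k)))"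
      by (rule target.homotopic_pconcat_left[OF slide]) (use p a E in auto)
    also have "\<dots> = pconcat Y (pconcat Y (path_map X Y f \<phi> p) ?E)
      (Elt (pter (pconcat Y (path_map X Y f \<phi> p) ?E)) (psi Y (emap f a) ?k))"
      using p a kc by (subst target.pconcat_assoc) (auto simp: E)
    finally show "pconcat Y (path_map X Y f \<eta> p) ?E \<simeq>\<^bsub>Y\<^esub> \<dots>" .
    show "is_path Y (pconcat Y (path_map X Y f \<phi> p) ?E)" using p a E by auto
    show "psi Y (emap f a) ?k \<in> carrier (grp Y (pter (pconcat Y (path_map X Y f \<phi> p) ?E)))"
      using p a kc E by auto
  qed
  \<comment> \<open>The unions range over all members of a class, so each member must again start at
    the base vertex and end where \<open>p\<close> does, as \<open>vertex\<close> and
    \<open>edge\<close> require.\<close>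
  have mem: "is_path X q \<and> pini X q = \<sigma>\<^sub>0 \<and> pter q = pter p"
    if q: "q \<in> universal_class X \<sigma>\<^sub>0 p" and p: "p \<in> paths_from X \<sigma>\<^sub>0" for p q
  proof -
    have p': "is_path X p" using p by (simp add: paths_from_def)
    then obtain g where "q \<simeq>\<^bsub>X\<^esub> pconcat X p (Elt (pter p) g)" and "pini X q = \<sigma>\<^sub>0"
      using q by (auto simp: source.universal_class_iff)
    then show ?thesis using source.homotopic_ends(1,4) by fastforce
  qed
  have v: "(\<Union>p\<in>u. universal_class Y \<tau>\<^sub>0 (path_map X Y f \<phi> p))
      = (\<Union>p\<in>u. universal_class Y \<tau>\<^sub>0 (path_map X Y f \<eta> p))"
    if "u = universal_class X \<sigma>\<^sub>0 p" "p \<in> paths_from X \<sigma>\<^sub>0" for u p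
    unfolding that(1) using mem[OF _ that(2)] vertex by (intro SUP_cong refl) blast
  have e: "(\<Union>p\<in>u. universal_class Y \<tau>\<^sub>0 (pconcat Y (path_map X Y f \<phi> p) (edge_path Y (Fwd (emap f a)))))
      = (\<Union>p\<in>u. universal_class Y \<tau>\<^sub>0 (pconcat Y (path_map X Y f \<eta> p) (edge_path Y (Fwd (emap f a)))))"
    if "u = universal_class X \<sigma>\<^sub>0 p" "p \<in> paths_from X \<sigma>\<^sub>0" "a \<in> edges X" "ini X a = pter p" for u p a
    unfolding that(1) using mem[OF _ that(2)] edge[OF _ _ that(3)] that(4)
    by (intro SUP_cong refl) metis
  show ?thesis
    unfolding universal_map_def
  proof (intro arg_cong2[where f = "\<lambda>m n. \<lparr>vmap = m, emap = n\<rparr>"] restrict_ext)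
    fix u assume "u \<in> verts (universal_complex X \<sigma>\<^sub>0)"
    then obtain p where "u = universal_class X \<sigma>\<^sub>0 p" "p \<in> paths_from X \<sigma>\<^sub>0"
      by (auto simp: universal_complex_def)
    then show "(\<Union>p\<in>u. universal_class Y \<tau>\<^sub>0 (path_map X Y f \<phi> p))
      = (\<Union>p\<in>u. universal_class Y \<tau>\<^sub>0 (path_map X Y f \<eta> p))"
      by (rule v)
  next
    fix t assume "t \<in> edges (universal_complex X \<sigma>\<^sub>0)"
    then obtain u a w p where t: "t = (u, a, w)"
      and p: "u = universal_class X \<sigma>\<^sub>0 p" "p \<in> paths_from X \<sigma>\<^sub>0" "a \<in> edges X" "ini X a = pter p"
      unfolding universal_complex_def by auto
    show "(case t of (u, a, w) \<Rightarrow>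
        (\<Union>p\<in>u. universal_class Y \<tau>\<^sub>0 (path_map X Y f \<phi> p), emap f a,
         \<Union>p\<in>u. universal_class Y \<tau>\<^sub>0 (pconcat Y (path_map X Y f \<phi> p) (edge_path Y (Fwd (emap f a))))))
      = (case t of (u, a, w) \<Rightarrow>
        (\<Union>p\<in>u. universal_class Y \<tau>\<^sub>0 (path_map X Y f \<eta> p), emap f a,
         \<Union>p\<in>u. universal_class Y \<tau>\<^sub>0 (pconcat Y (path_map X Y f \<eta> p) (edge_path Y (Fwd (emap f a))))))"
      unfolding t prod.case v[OF p(1,2)] e[OF p] ..
  qed
qed

section \<open>Equal induced maps yield a homotopy\<close>

lemma path_map_homotopic_if_universal_map_eq:
  assumes "universal_map X Y f \<phi> \<sigma>\<^sub>0 \<tau>\<^sub>0 = universal_map X Y f \<eta> \<sigma>\<^sub>0 \<tau>\<^sub>0" "vmap f \<sigma>\<^sub>0 = \<tau>\<^sub>0"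
    and p: "is_path X p" "pini X p = \<sigma>\<^sub>0"
  obtains g where "g \<in> carrier (grp Y (vmap f (pter p)))"
    "path_map X Y f \<phi> p \<simeq>\<^bsub>Y\<^esub> pconcat Y (path_map X Y f \<eta> p) (Elt (vmap f (pter p)) g)"
proof -
  let ?u = "universal_class X \<sigma>\<^sub>0 p"
  have "?u \<in> verts (universal_complex X \<sigma>\<^sub>0)"
    using p by (auto simp: universal_complex_def paths_from_def)
  then have "(\<Union>q\<in>?u. universal_class Y \<tau>\<^sub>0 (path_map X Y f \<phi> q))
      = (\<Union>q\<in>?u. universal_class Y \<tau>\<^sub>0 (path_map X Y f \<eta> q))"
    using fun_cong[OF arg_cong[OF assms(1), of vmap], of ?u] by (simp add: universal_map_def)
  moreover have "p \<in> ?u" using source.universal_class_self[OF p(1)] p by simp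
  moreover have "path_map X Y f \<phi> p \<in> universal_class Y \<tau>\<^sub>0 (path_map X Y f \<phi> p)"
    using target.universal_class_self[of "path_map X Y f \<phi> p"] p assms(2) by simp
  \<comment> \<open>Equality of unions yields some member \<open>q\<close> in place of
    \<open>p\<close>. As \<open>q\<close> is \<open>p\<close> followed by some \<open>h\<close>,
    passing back to \<open>p\<close> multiplies \<open>g\<close> by the \<eta>-image of
    \<open>h\<close>.\<close>
  ultimately obtain q where q: "q \<in> ?u"
    "path_map X Y f \<phi> p \<in> universal_class Y \<tau>\<^sub>0 (path_map X Y f \<eta> q)" by blast
  obtain h where h: "h \<in> carrier (grp X (pter p))" "q \<simeq>\<^bsub>X\<^esub> pconcat X p (Elt (pter p) h)"
    using q(1) p by (auto simp: source.universal_class_iff)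
  note ends = source.homotopic_ends[OF h(2)]
  obtain g where g: "g \<in> carrier (grp Y (vmap f (pter p)))"
    "path_map X Y f \<phi> p \<simeq>\<^bsub>Y\<^esub> pconcat Y (path_map X Y f \<eta> q) (Elt (vmap f (pter p)) g)"
    using q(2) ends by (auto simp: target.universal_class_iff)
  note g(2)
  also have "pconcat Y (path_map X Y f \<eta> q) (Elt (vmap f (pter p)) g) \<simeq>\<^bsub>Y\<^esub>
      pconcat Y (path_map X Y f \<eta> (pconcat X p (Elt (pter p) h))) (Elt (vmap f (pter p)) g)"
    by (rule target.homotopic_pconcat_right[OF second.path_map_homotopic[OF h(2)]])
      (use p g ends in auto)
  also have "\<dots> = pconcat Y (path_map X Y f \<eta> p)
      (Elt (vmap f (pter p)) (loc \<eta> (pter p) h \<otimes>\<^bsub>grp Y (vmap f (pter p))\<^esub> g))"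
    using p g h by (simp add: second.path_map_pconcat target.pconcat_assoc)
  finally show ?thesis using p g h by (intro that) auto
qed

lemma path_map_homotopic_if_pi1_map_eq:
  assumes "pi1_map X Y f \<phi> \<sigma>\<^sub>0 = pi1_map X Y f \<eta> \<sigma>\<^sub>0"
    and l: "is_path X l" "pini X l = \<sigma>\<^sub>0" "pter l = \<sigma>\<^sub>0"
  shows "path_map X Y f \<phi> l \<simeq>\<^bsub>Y\<^esub> path_map X Y f \<eta> l"
proof -
  let ?A = "homotopy_class X l"
  have "?A \<in> carrier (pi1 X \<sigma>\<^sub>0)"
    using l by (auto simp: pi1_def loops_at_def paths_from_def)
  then have "(\<Union>p\<in>?A. homotopy_class Y (path_map X Y f \<phi> p))
      = (\<Union>p\<in>?A. homotopy_class Y (path_map X Y f \<eta> p))"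
    using fun_cong[OF assms(1), of ?A] by (simp add: pi1_map_def)
  moreover have "l \<in> ?A" "path_map X Y f \<phi> l \<in> homotopy_class Y (path_map X Y f \<phi> l)"
    using l source.homotopic_refl target.homotopic_refl[of "path_map X Y f \<phi> l"]
    by (auto simp: homotopy_class_def homotopic_def)
  ultimately obtain p where "p \<in> ?A" "path_map X Y f \<phi> l \<in> homotopy_class Y (path_map X Y f \<eta> p)"
    by blast
  then have "l \<simeq>\<^bsub>X\<^esub> p" "path_map X Y f \<eta> p \<simeq>\<^bsub>Y\<^esub> path_map X Y f \<phi> l"
    by (simp_all add: homotopy_class_def homotopic_def)
  then show ?thesis
    using second.path_map_homotopic target.homotopic_trans target.homotopic_sym by blast
qed

text \<open>Up to homotopy, \<open>q\<close> is a loop followed by \<open>p\<close>, namely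
  \<open>q\<close> followed by a reverse of \<open>p\<close>. Both morphisms agree on the loop, so
  they differ on \<open>q\<close> by the same element as on \<open>p\<close>.\<close>

lemma path_map_discrepancy_unique:
  assumes "pi1_map X Y f \<phi> \<sigma>\<^sub>0 = pi1_map X Y f \<eta> \<sigma>\<^sub>0"
    and p: "is_path X p" "pini X p = \<sigma>\<^sub>0" and q: "is_path X q" "pini X q = \<sigma>\<^sub>0" "pter q = pter p"
    and g: "g \<in> carrier (grp Y (vmap f (pter p)))"
    and eq: "path_map X Y f \<phi> p \<simeq>\<^bsub>Y\<^esub> pconcat Y (path_map X Y f \<eta> p) (Elt (vmap f (pter p)) g)"
  shows "path_map X Y f \<phi> q \<simeq>\<^bsub>Y\<^esub> pconcat Y (path_map X Y f \<eta> q) (Elt (vmap f (pter p)) g)"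
proof -
  obtain r where r: "is_path X r" "pini X r = pter p" "pter r = pini X p"
    "pconcat X r p \<simeq>\<^bsub>X\<^esub> Elt (pter p) \<one>\<^bsub>grp X (pter p)\<^esub>"
    using source.reverse_path_exists[OF p(1)] by metis
  let ?l = "pconcat X q r" and ?g = "Elt (vmap f (pter p)) g"
  have l: "is_path X ?l" "pini X ?l = \<sigma>\<^sub>0" "pter ?l = \<sigma>\<^sub>0" using p q r by auto
  have "pconcat X ?l p = pconcat X q (pconcat X r p)"
    using p q r by (simp add: source.pconcat_assoc)
  also have "\<dots> \<simeq>\<^bsub>X\<^esub> pconcat X q (Elt (pter p) \<one>\<^bsub>grp X (pter p)\<^esub>)"
    by (rule source.homotopic_pconcat_left) (use p q r in auto)
  finally have lp: "pconcat X ?l p \<simeq>\<^bsub>X\<^esub> q" using q by simp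
  have "path_map X Y f \<phi> q \<simeq>\<^bsub>Y\<^esub> path_map X Y f \<phi> (pconcat X ?l p)"
    using first.path_map_homotopic[OF lp] by (rule target.homotopic_sym)
  also have "\<dots> = pconcat Y (path_map X Y f \<phi> ?l) (path_map X Y f \<phi> p)"
    using p l by (intro first.path_map_pconcat) auto
  also have "\<dots> \<simeq>\<^bsub>Y\<^esub> pconcat Y (path_map X Y f \<eta> ?l) (path_map X Y f \<phi> p)"
    by (rule target.homotopic_pconcat_right[OF path_map_homotopic_if_pi1_map_eq[OF assms(1) l]])
      (use p l in auto)
  also have "\<dots> \<simeq>\<^bsub>Y\<^esub> pconcat Y (path_map X Y f \<eta> ?l) (pconcat Y (path_map X Y f \<eta> p) ?g)"
    by (rule target.homotopic_pconcat_left[OF eq]) (use p l in auto)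
  also have "\<dots> = pconcat Y (path_map X Y f \<eta> (pconcat X ?l p)) ?g"
    using p l g by (subst second.path_map_pconcat) (auto simp: target.pconcat_assoc)
  also have "\<dots> \<simeq>\<^bsub>Y\<^esub> pconcat Y (path_map X Y f \<eta> q) ?g"
    by (rule target.homotopic_pconcat_right[OF second.path_map_homotopic[OF lp]]) (use p l g in auto)
  finally show ?thesis .
qed

lemma homotopic_rel_if_induced_maps_eq:
  assumes "developable Y" "\<sigma>\<^sub>0 \<in> verts X" "vmap f \<sigma>\<^sub>0 = \<tau>\<^sub>0"
    and pi1: "pi1_map X Y f \<phi> \<sigma>\<^sub>0 = pi1_map X Y f \<eta> \<sigma>\<^sub>0"
    and univ: "universal_map X Y f \<phi> \<sigma>\<^sub>0 \<tau>\<^sub>0 = universal_map X Y f \<eta> \<sigma>\<^sub>0 \<tau>\<^sub>0"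
  shows "homotopic_rel X Y f \<phi> \<eta> \<sigma>\<^sub>0"
proof -
  let ?P = "path_map X Y f \<phi>" and ?Q = "path_map X Y f \<eta>"
  \<comment> \<open>Developability of the target turns a homotopy of paths of length zero into an
    equation in a local group.\<close>
  have Elt_inj: "g = h" if "Elt \<tau> g \<simeq>\<^bsub>Y\<^esub> Elt \<tau> h" for \<tau> g h
    using that target.homotopic_ends[OF that] assms(1)
    by (auto simp: developable_def target.homotopy_class_eq_iff inj_on_def)
  \<comment> \<open>One element has to serve all paths to \<sigma> at once, so that the chosen
    \<open>k\<close> fits both \<open>p\<close> and its extensions below.\<close>
  have "\<forall>\<sigma>\<in>verts X. \<exists>g. g \<in> carrier (grp Y (vmap f \<sigma>)) \<and>
    (\<forall>p. is_path X p \<longrightarrow> pini X p = \<sigma>\<^sub>0 \<longrightarrow> pter p = \<sigma> \<longrightarrow>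
      ?P p \<simeq>\<^bsub>Y\<^esub> pconcat Y (?Q p) (Elt (vmap f \<sigma>) g))"
  proof
    fix \<sigma> assume "\<sigma> \<in> verts X"
    then obtain p where p: "is_path X p" "pini X p = \<sigma>\<^sub>0" "pter p = \<sigma>"
      using source.path_exists[OF assms(2)] by blast
    obtain g where g: "g \<in> carrier (grp Y (vmap f (pter p)))"
      "?P p \<simeq>\<^bsub>Y\<^esub> pconcat Y (?Q p) (Elt (vmap f (pter p)) g)"
      by (rule path_map_homotopic_if_universal_map_eq[OF univ assms(3) p(1,2)])
    then show "\<exists>g. g \<in> carrier (grp Y (vmap f \<sigma>)) \<and>
      (\<forall>p. is_path X p \<longrightarrow> pini X p = \<sigma>\<^sub>0 \<longrightarrow> pter p = \<sigma> \<longrightarrow>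
        ?P p \<simeq>\<^bsub>Y\<^esub> pconcat Y (?Q p) (Elt (vmap f \<sigma>) g))"
      using path_map_discrepancy_unique[OF pi1 p(1,2) _ _ _ g] p(3) by blast
  qed
  from bchoice[OF this] obtain k where
    "\<forall>\<sigma>\<in>verts X. k \<sigma> \<in> carrier (grp Y (vmap f \<sigma>)) \<and>
      (\<forall>p. is_path X p \<longrightarrow> pini X p = \<sigma>\<^sub>0 \<longrightarrow> pter p = \<sigma> \<longrightarrow>
        ?P p \<simeq>\<^bsub>Y\<^esub> pconcat Y (?Q p) (Elt (vmap f \<sigma>) (k \<sigma>)))" ..
  then have k: "\<And>\<sigma>. \<sigma> \<in> verts X \<Longrightarrow> k \<sigma> \<in> carrier (grp Y (vmap f \<sigma>))"
    and PQ: "\<And>p. \<lbrakk>is_path X p; pini X p = \<sigma>\<^sub>0\<rbrakk> \<Longrightarrow>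
      ?P p \<simeq>\<^bsub>Y\<^esub> pconcat Y (?Q p) (Elt (vmap f (pter p)) (k (pter p)))"
    by simp_all
  text \<open>Comparing \<open>PQ\<close> for \<open>p\<close> and for \<open>p \<star> q\<close>.\<close>
  have step: "left_mult Y (k (pini X q)) (?P q) \<simeq>\<^bsub>Y\<^esub>
      pconcat Y (?Q q) (Elt (vmap f (pter q)) (k (pter q)))" if q: "is_path X q" for q
  proof -
    obtain p where p: "is_path X p" "pini X p = \<sigma>\<^sub>0" "pter p = pini X q"
      using source.path_exists[OF assms(2) source.pini_closed[OF q]] by blast
    let ?k = "Elt (vmap f (pter p)) (k (pter p))" and ?l = "Elt (vmap f (pter q)) (k (pter q))"
    have "pconcat Y (?Q p) (left_mult Y (k (pini X q)) (?P q)) = pconcat Y (pconcat Y (?Q p) ?k) (?P q)"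
      using p q k by (simp add: target.pconcat_assoc)
    also have "\<dots> \<simeq>\<^bsub>Y\<^esub> pconcat Y (?P p) (?P q)"
      by (rule target.homotopic_pconcat_right[OF target.homotopic_sym[OF PQ[OF p(1,2)]]])
        (use p q in auto)
    also have "\<dots> = ?P (pconcat X p q)" using p q by (simp add: first.path_map_pconcat)
    also have "\<dots> \<simeq>\<^bsub>Y\<^esub> pconcat Y (?Q (pconcat X p q)) ?l"
      using PQ[of "pconcat X p q"] p q by simp
    also have "\<dots> = pconcat Y (?Q p) (pconcat Y (?Q q) ?l)"
      using p q k by (simp add: second.path_map_pconcat target.pconcat_assoc)
    \<comment> \<open>The common initial path \<open>Q p\<close> is cancelled;
      \<open>rotated 5\<close> feeds the derived homotopy into the sixth premise.\<close>
    finally show ?thesis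
      by (rule target.homotopic_pconcat_cancel[rotated 5]) (use p q k in auto)
  qed
  have loc: "k \<sigma> \<otimes>\<^bsub>grp Y (vmap f \<sigma>)\<^esub> loc \<phi> \<sigma> g = loc \<eta> \<sigma> g \<otimes>\<^bsub>grp Y (vmap f \<sigma>)\<^esub> k \<sigma>"
    if "\<sigma> \<in> verts X" "g \<in> carrier (grp X \<sigma>)" for \<sigma> g
    using step[of "Elt \<sigma> g"] that by (auto intro: Elt_inj)
  have elt: "psi Y (emap f a) (k (ini X a)) \<otimes>\<^bsub>grp Y (vmap f (ter X a))\<^esub> inv\<^bsub>grp Y (vmap f (ter X a))\<^esub> elt \<phi> a
      = inv\<^bsub>grp Y (vmap f (ter X a))\<^esub> elt \<eta> a \<otimes>\<^bsub>grp Y (vmap f (ter X a))\<^esub> k (ter X a)"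
    if a: "a \<in> edges X" for a
  proof -
    let ?G = "grp Y (vmap f (ter X a))" and ?H = "grp Y (vmap f (ini X a))" and ?\<tau> = "vmap f (ter X a)"
    \<comment> \<open>For \<open>(1, a, 1)\<close> the two sides of \<open>step\<close> begin with
      \<open>k\<close> and with 1. Sliding \<open>k\<close> across \<open>f(a)\<close> makes the
      beginnings equal, so that the edge can be cancelled.\<close>
    have "Step \<one>\<^bsub>?H\<^esub> (Fwd (emap f a)) (Elt ?\<tau> (psi Y (emap f a) (k (ini X a)) \<otimes>\<^bsub>?G\<^esub> inv\<^bsub>?G\<^esub> elt \<phi> a))
        \<simeq>\<^bsub>Y\<^esub> Step (k (ini X a)) (Fwd (emap f a)) (Elt ?\<tau> (inv\<^bsub>?G\<^esub> elt \<phi> a))"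
      using target.homotopic_slide_fwd[of "emap f a" "\<one>\<^bsub>?H\<^esub>" "k (ini X a)" "Elt ?\<tau> (inv\<^bsub>?G\<^esub> elt \<phi> a)"] a k
      by (auto intro: target.homotopic_sym)
    also have "\<dots> \<simeq>\<^bsub>Y\<^esub> Step \<one>\<^bsub>?H\<^esub> (Fwd (emap f a)) (Elt ?\<tau> (inv\<^bsub>?G\<^esub> elt \<eta> a \<otimes>\<^bsub>?G\<^esub> k (ter X a)))"
      using step[of "edge_path X (Fwd a)"] a k by (simp add: edge_path_def)
    finally have "Elt ?\<tau> (psi Y (emap f a) (k (ini X a)) \<otimes>\<^bsub>?G\<^esub> inv\<^bsub>?G\<^esub> elt \<phi> a)
        \<simeq>\<^bsub>Y\<^esub> Elt ?\<tau> (inv\<^bsub>?G\<^esub> elt \<eta> a \<otimes>\<^bsub>?G\<^esub> k (ter X a))"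
      using target.homotopic_Fwd_cancel[of "emap f a"] a k by simp
    then show ?thesis by (rule Elt_inj)
  qed
  \<comment> \<open>On the constant path both images are \<open>(1)\<close>, so the discrepancy
    there is 1.\<close>
  have "k \<sigma>\<^sub>0 = \<one>\<^bsub>grp Y (vmap f \<sigma>\<^sub>0)\<^esub>"
    using PQ[of "Elt \<sigma>\<^sub>0 \<one>\<^bsub>grp X \<sigma>\<^sub>0\<^esub>"] assms(2) k by (auto dest: Elt_inj)
  moreover have "is_homotopy X Y f \<phi> \<eta> k"
    unfolding is_homotopy_def
  proof (intro conjI ballI)
    fix \<sigma> g assume *: "\<sigma> \<in> verts X" "g \<in> carrier (grp X \<sigma>)"
    show "loc \<eta> \<sigma> g = conj_by (grp Y (vmap f \<sigma>)) (k \<sigma>) (loc \<phi> \<sigma> g)"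
      using * k by (simp add: conj_by_def loc target.grp_assoc)
  next
    fix a assume a: "a \<in> edges X"
    let ?G = "grp Y (vmap f (ter X a))" and ?p = "psi Y (emap f a) (k (ini X a))"
    have p: "?p \<in> carrier ?G" using a k by simp
    \<comment> \<open>Solves \<open>elt\<close> for \<eta>(a): the inverses of \<eta>(a) and of
      \<phi>(a) are cleared first, then the \<open>psi\<close> factor is moved to the other
      side.\<close>
    have "k (ter X a) = elt \<eta> a \<otimes>\<^bsub>?G\<^esub> (inv\<^bsub>?G\<^esub> elt \<eta> a \<otimes>\<^bsub>?G\<^esub> k (ter X a))"
      using a k by simp
    also have "\<dots> = elt \<eta> a \<otimes>\<^bsub>?G\<^esub> (?p \<otimes>\<^bsub>?G\<^esub> inv\<^bsub>?G\<^esub> elt \<phi> a)" using elt[OF a] by simp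
    finally have "k (ter X a) \<otimes>\<^bsub>?G\<^esub> elt \<phi> a \<otimes>\<^bsub>?G\<^esub> inv\<^bsub>?G\<^esub> ?p = elt \<eta> a"
      using a p by (simp add: target.grp_assoc)
    then show "elt \<eta> a = k (ter X a) \<otimes>\<^bsub>?G\<^esub> elt \<phi> a
        \<otimes>\<^bsub>?G\<^esub> psi Y (emap f a) (inv\<^bsub>grp Y (vmap f (ini X a))\<^esub> k (ini X a))"
      using target.psi_inv[of "emap f a" "k (ini X a)"] a k by simp
  qed (use k in simp)
  ultimately show ?thesis by (auto simp: homotopic_rel_def)
qed

end

theorem corollary4p4:
  fixes X :: "('v, 'e, 'g) group_complex" and Y :: "('w, 'd, 'h) group_complex"
    and f :: "('v, 'e, 'w, 'd) scwol_map"
    and \<phi> \<eta> :: "('v, 'e, 'g, 'h) complex_map"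
    and \<sigma>\<^sub>0 :: 'v and \<tau>\<^sub>0 :: 'w
  assumes "complex_of_groups X" and "complex_of_groups Y"
    and "developable X" and "developable Y"
    and "scwol_morphism X Y f"
    and "complex_morphism X Y f \<phi>" and "complex_morphism X Y f \<eta>"
    and "\<sigma>\<^sub>0 \<in> verts X" and "vmap f \<sigma>\<^sub>0 = \<tau>\<^sub>0"
  shows "homotopic_rel X Y f \<phi> \<eta> \<sigma>\<^sub>0 \<longleftrightarrow>
    pi1_map X Y f \<phi> \<sigma>\<^sub>0 = pi1_map X Y f \<eta> \<sigma>\<^sub>0 \<and>
    universal_map X Y f \<phi> \<sigma>\<^sub>0 \<tau>\<^sub>0 = universal_map X Y f \<eta> \<sigma>\<^sub>0 \<tau>\<^sub>0"
proof -
  interpret morphism_pair X Y f \<phi> \<eta>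
    using assms by (simp add: morphism_pair_def)
  show ?thesis
    using homotopic_rel_imp_pi1_map_eq homotopic_rel_imp_universal_map_eq
      homotopic_rel_if_induced_maps_eq[OF assms(4,8,9)] by blast
qed

end
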